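(* Let $N$ be a supernatural number, $n\in\mathbb Z$, and let $\delta$ be an $n$-covariant derivation in $B(N)$. Any covariant implementation $D_{\tau_0}:\mathcal D_{\tau_0}\to\ell^2(\mathbb Z)$ of $\delta$ in the GNS Hilbert space of the state $\tau_0$ is of the form $$D_{\tau_0}=\begin{cases}V^n\eta_n(\mathbb L)&\text{for } n\neq0,\\ \eta_0(\mathbb L)+c\cdot I&\text{for } n=0,\end{cases}$$ with arbitrary constant $c$ for $n=0$, where $\eta_n(\mathbb L)$ is a diagonal operator with $\delta(b)=[V^n\eta_n(\mathbb L),b]$ for all $b\in\mathcal B(N)$. If $N$ is infinite and $n\neq0$, or if $N$ is finite and $N\nmid n$, then the operator $D_{\tau_0}$ is bounded, so it does not have compact parametrices. In all other cases, $|\eta_n(l)|\to\infty$ as $|l|\to\infty$ is a necessary and sufficient condition for $D_{\tau_0}$ to have compact parametrices.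
   Context: A supernatural number is a formal product $N=\prod_{p\text{ prime}}p^{\epsilon_p}$ with $\epsilon_p\in\{0,1,\dots,\infty\}$; it is finite (an ordinary positive integer) if $\sum_p\epsilon_p<\infty$, and infinite otherwise. A positive integer $j$ divides $N$ ($j\mid N$) if for each prime $p$ the exponent of $p$ in $j$ is at most $\epsilon_p$. On $\ell^2(\mathbb Z)$ with canonical basis $\{E_l\}_{l\in\mathbb Z}$ let $VE_l=E_{l+1}$ be the bilateral shift, $\mathbb LE_l=lE_l$, and for a sequence $b(l)$ let $b(\mathbb L)E_l=b(l)E_l$ (a diagonal operator). Let $\mathcal B_{\mathrm{diag}}(N)=\{b(\mathbb L): b(l+j)=b(l)\ \forall l,\text{ for some positive integer } j\mid N\}$ with norm closure $B_{\mathrm{diag}}(N)$. The Bunce-Deddens algebra is (up to isomorphism) $B(N)=\mathrm C^*(V,\mathcal B_{\mathrm{diag}}(N))$; $\mathcal B(N)$ is the $^*$-subalgebra of finite sums $\sum_nV^nb_n(\mathbb L)$ with $b_n(\mathbb L)\in\mathcal B_{\mathrm{diag}}(N)$. A derivation in $B(N)$ is a linear map $\delta:\mathcal B(N)\to B(N)$ satisfying the Leibniz rule. Let $\rho_\theta(b)=e^{i\theta\mathbb L}be^{-i\theta\mathbb L}$. $\delta$ is $n$-covariant if $\rho_\theta^{-1}(\delta(\rho_\theta(b)))=e^{-in\theta}\delta(b)$ for all $\theta\in[0,2\pi)$, $b\in\mathcal B(N)$. Every $n$-covariant $\delta$ has the form $\delta(b)=[V^n\eta_n(\mathbb L),b]$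 (commutator computed on the linear span of $\{E_l\}$) for a diagonal operator $\eta_n(\mathbb L)$, with $\eta_n(\mathbb L)\in B_{\mathrm{diag}}(N)$ if $N$ is infinite and $n\ne0$ or $N$ is finite and $N\nmid n$, and $\eta_n(\mathbb L+I)-\eta_n(\mathbb L)\in B_{\mathrm{diag}}(N)$ otherwise. State: let $E(b)=\frac1{2\pi}\int_0^{2\pi}\rho_\theta(b)\,d\theta\in B_{\mathrm{diag}}(N)$, and $\tau_0(b)=\langle E_0,E(b)E_0\rangle$ (the value at $0$ of the diagonal part of $b$). Its GNS Hilbert space is identified with $\ell^2(\mathbb Z)$ by $[\sum_nV^nb_n(\mathbb L)]\mapsto\{b_n(0)\}_{n\in\mathbb Z}$; then $[I]=E_0$, the GNS representation is the defining representation $\pi_0(b)=b$, and $\mathcal D_{\tau_0}=\pi_0(\mathcal B(N))[I]$ is the space of finitely supported sequences. Let $V_{\tau_0,\theta}$ be the unitary with $V_{\tau_0,\theta}[b]=[\rho_\theta(b)]$. A covariant implementation of $\delta$ is a linear operator $D_{\tau_0}:\mathcal D_{\tau_0}\to\ell^2(\mathbb Z)$ with $[D_{\tau_0},\pi_0(b)]=\pi_0(\delta(b))$ on $\mathcal D_{\tau_0}$ for all $b\in\mathcal B(N)$ and $V_{\tau_0,\theta}D_{\tau_0}V_{\tau_0,\theta}^{-1}=e^{in\theta}D_{\tau_0}$ for all $\theta$. An operator $D$ (replaced by its closure) has compact parametrices if and only if $(I+D^*D)^{-1/2}$ and $(I+DD^* )^{-1/2}$ are compact; take this as the definition. *)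

theory Defs
  imports
    "HOL-Analysis.Analysis"
    "HOL-Computational_Algebra.Primes"
    "HOL-Library.Extended_Nat"
begin

section \<open>Supernatural numbers\<close>

text \<open>\<open>N p\<close> is the exponent of the prime \<open>p\<close>; the values of \<open>N\<close> at non-primes are ignored everywhere.\<close>

type_synonym supernatural = "nat \<Rightarrow> enat"

definition sn_finite :: "supernatural \<Rightarrow> bool" where
  "sn_finite N \<longleftrightarrow> infsum N {p. prime p} < \<infinity>"

definition sn_dvd :: "nat \<Rightarrow> supernatural \<Rightarrow> bool" where
  "sn_dvd j N \<longleftrightarrow> 0 < j \<and> (\<forall>p. prime p \<longrightarrow> enat (multiplicity p j) \<le> N p)"

text \<open>The positive integer denoted by a finite supernatural number (no meaning otherwise).\<close>

definition sn_nat :: "supernatural \<Rightarrow> nat" where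
  "sn_nat N = (\<Prod>p | prime p \<and> N p \<noteq> 0. p ^ the_enat (N p))"


section \<open>The Hilbert space of square-summable bilateral sequences\<close>

typedef ell2 = "{f :: int \<Rightarrow> complex. (\<lambda>l. (cmod (f l))\<^sup>2) summable_on UNIV}"
  morphisms coord Abs_ell2
  by (rule exI[of _ "\<lambda>_. 0"]) simp

lemma coord_summable: "(\<lambda>l. (cmod (coord x l))\<^sup>2) summable_on UNIV"
  using coord by blast

lemma ell2_eqI: "(\<And>l. coord x l = coord y l) \<Longrightarrow> x = y"
  by (simp add: coord_inject[symmetric] fun_eq_iff)

lemma sqs_add:
  fixes f g :: "int \<Rightarrow> complex"
  assumes "(\<lambda>l. (cmod (f l))\<^sup>2) summable_on UNIV" "(\<lambda>l. (cmod (g l))\<^sup>2) summable_on UNIV"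
  shows "(\<lambda>l. (cmod (f l + g l))\<^sup>2) summable_on UNIV"
proof (rule summable_on_comparison_test)
  show "(\<lambda>l. 2 * ((cmod (f l))\<^sup>2 + (cmod (g l))\<^sup>2)) summable_on UNIV"
    by (intro summable_on_cmult_right summable_on_add assms)
  fix l
  have "(cmod (f l + g l))\<^sup>2 \<le> (cmod (f l) + cmod (g l))\<^sup>2"
    by (intro power_mono norm_triangle_ineq) simp
  also have "\<dots> \<le> 2 * ((cmod (f l))\<^sup>2 + (cmod (g l))\<^sup>2)"
    using sum_squares_bound[of "cmod (f l)" "cmod (g l)"] by (simp add: power2_sum)
  finally show "(cmod (f l + g l))\<^sup>2 \<le> 2 * ((cmod (f l))\<^sup>2 + (cmod (g l))\<^sup>2)" .
qed simp

lemma sqs_mult: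
  fixes f b :: "int \<Rightarrow> complex"
  assumes "(\<lambda>l. (cmod (f l))\<^sup>2) summable_on UNIV" and "\<And>l. cmod (b l) \<le> K"
  shows "(\<lambda>l. (cmod (b l * f l))\<^sup>2) summable_on UNIV"
proof (rule summable_on_comparison_test)
  show "(\<lambda>l. K\<^sup>2 * (cmod (f l))\<^sup>2) summable_on UNIV"
    by (intro summable_on_cmult_right assms)
  fix l show "(cmod (b l * f l))\<^sup>2 \<le> K\<^sup>2 * (cmod (f l))\<^sup>2"
    by (simp add: norm_mult power_mult_distrib assms mult_right_mono power_mono)
qed simp

lemma bij_shift: "bij_betw (\<lambda>l::int. l - k) UNIV UNIV"
  by (rule bij_betwI[where g = "\<lambda>l. l + k"]) auto

lemma sqs_shift:
  fixes f :: "int \<Rightarrow> complex"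
  assumes "(\<lambda>l. (cmod (f l))\<^sup>2) summable_on UNIV"
  shows "(\<lambda>l. (cmod (f (l - k)))\<^sup>2) summable_on UNIV"
  using summable_on_reindex_bij_betw[OF bij_shift, of "\<lambda>l. (cmod (f l))\<^sup>2" k] assms by simp

lemma sqs_cinner_abs:
  fixes f g :: "int \<Rightarrow> complex"
  assumes "(\<lambda>l. (cmod (f l))\<^sup>2) summable_on UNIV" "(\<lambda>l. (cmod (g l))\<^sup>2) summable_on UNIV"
  shows "(\<lambda>l. cmod (cnj (f l) * g l)) summable_on UNIV"
proof (rule Infinite_Sum.abs_summable_on_comparison_test')
  show "(\<lambda>l. (cmod (f l))\<^sup>2 + (cmod (g l))\<^sup>2) summable_on UNIV"
    by (intro summable_on_add assms)
  fix l
  have "2 * (cmod (f l) * cmod (g l)) \<le> (cmod (f l))\<^sup>2 + (cmod (g l))\<^sup>2"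
    using sum_squares_bound[of "cmod (f l)" "cmod (g l)"] by simp
  moreover have "0 \<le> cmod (f l) * cmod (g l)" by simp
  ultimately show "cmod (cnj (f l) * g l) \<le> (cmod (f l))\<^sup>2 + (cmod (g l))\<^sup>2"
    by (simp only: norm_mult complex_mod_cnj)
qed

definition cscale :: "complex \<Rightarrow> ell2 \<Rightarrow> ell2" where
  "cscale c x = Abs_ell2 (\<lambda>l. c * coord x l)"

text \<open>The inner product is conjugate-linear in its first argument.\<close>

definition cinner :: "ell2 \<Rightarrow> ell2 \<Rightarrow> complex" where
  "cinner x y = (\<Sum>\<^sub>\<infinity>l. cnj (coord x l) * coord y l)"

instantiation ell2 :: real_vector
begin

definition zero_ell2 :: ell2 where "0 = Abs_ell2 (\<lambda>_. 0)"
definition plus_ell2 :: "ell2 \<Rightarrow> ell2 \<Rightarrow> ell2" where "(x::ell2) + y = Abs_ell2 (\<lambda>l. coord x l + coord y l)"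
definition uminus_ell2 :: "ell2 \<Rightarrow> ell2" where "- (x::ell2) = Abs_ell2 (\<lambda>l. - coord x l)"
definition minus_ell2 :: "ell2 \<Rightarrow> ell2 \<Rightarrow> ell2" where "(x::ell2) - y = x + (- y)"
definition scaleR_ell2 :: "real \<Rightarrow> ell2 \<Rightarrow> ell2" where "r *\<^sub>R (x::ell2) = Abs_ell2 (\<lambda>l. r *\<^sub>R coord x l)"
lemma coord_0: "coord 0 l = 0"
  by (simp add: zero_ell2_def Abs_ell2_inverse)
lemma coord_add: "coord (x + y) l = coord x l + coord y l"
  by (simp add: plus_ell2_def Abs_ell2_inverse sqs_add coord_summable)
lemma coord_uminus: "coord (- x) l = - coord x l"
  by (simp add: uminus_ell2_def Abs_ell2_inverse coord_summable)
lemma coord_scaleR: "coord (r *\<^sub>R x) l = r *\<^sub>R coord x l"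
  using sqs_mult[OF coord_summable, of "\<lambda>_. of_real r" "\<bar>r\<bar>" x]
  by (simp add: scaleR_ell2_def Abs_ell2_inverse scaleR_conv_of_real)

instance
proof
  fix x y z :: ell2 and r s :: real
  show "x + y + z = x + (y + z)" by (rule ell2_eqI) (simp add: coord_add)
  show "x + y = y + x" by (rule ell2_eqI) (simp add: coord_add)
  show "0 + x = x" by (rule ell2_eqI) (simp add: coord_add coord_0)
  show "- x + x = 0" by (rule ell2_eqI) (simp add: coord_add coord_0 coord_uminus)
  show "x - y = x + - y" by (simp add: minus_ell2_def)
  show "r *\<^sub>R (x + y) = r *\<^sub>R x + r *\<^sub>R y"
    by (rule ell2_eqI) (simp add: coord_add coord_scaleR scaleR_add_right)
  show "(r + s) *\<^sub>R x = r *\<^sub>R x + s *\<^sub>R x"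
    by (rule ell2_eqI) (simp add: coord_add coord_scaleR scaleR_add_left)
  show "r *\<^sub>R s *\<^sub>R x = (r * s) *\<^sub>R x" by (rule ell2_eqI) (simp add: coord_scaleR)
  show "1 *\<^sub>R x = x" by (rule ell2_eqI) (simp add: coord_scaleR)
qed

end

instantiation ell2 :: real_inner
begin

definition inner_ell2 :: "ell2 \<Rightarrow> ell2 \<Rightarrow> real" where "inner (x::ell2) y = Re (cinner x y)"
definition norm_ell2 :: "ell2 \<Rightarrow> real" where "norm (x::ell2) = sqrt (inner x x)"
definition dist_ell2 :: "ell2 \<Rightarrow> ell2 \<Rightarrow> real" where "dist (x::ell2) y = norm (x - y)"
definition sgn_ell2 :: "ell2 \<Rightarrow> ell2" where "sgn (x::ell2) = x /\<^sub>R norm x"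
definition uniformity_ell2 :: "(ell2 \<times> ell2) filter" where
  "(uniformity :: (ell2 \<times> ell2) filter) = (INF e\<in>{0<..}. principal {(x, y). dist x y < e})"
definition open_ell2 :: "ell2 set \<Rightarrow> bool" where
  "open (U::ell2 set) = (\<forall>x\<in>U. \<forall>\<^sub>F (x', y) in uniformity. x' = x \<longrightarrow> y \<in> U)"

lemma cinner_abs_summable: "(\<lambda>l. cmod (cnj (coord x l) * coord y l)) summable_on UNIV"
  by (intro sqs_cinner_abs coord_summable)

lemma cinner_summable: "(\<lambda>l. cnj (coord x l) * coord y l) summable_on UNIV"
  by (rule abs_summable_summable[OF cinner_abs_summable])

lemma cinner_commute: "cinner x y = cnj (cinner y x)"
  by (simp add: cinner_def infsum_cnj[symmetric] mult.commute del: infsum_cnj)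

lemma cinner_add_left: "cinner (x + y) z = cinner x z + cinner y z"
  by (simp add: cinner_def coord_add distrib_right infsum_add cinner_summable)

lemma cinner_self: "cinner x x = of_real (\<Sum>\<^sub>\<infinity>l. (cmod (coord x l))\<^sup>2)"
proof -
  have "cinner x x = (\<Sum>\<^sub>\<infinity>l. of_real ((cmod (coord x l))\<^sup>2))"
    by (simp add: cinner_def mult.commute complex_norm_square del: of_real_power)
  also have "\<dots> = of_real (\<Sum>\<^sub>\<infinity>l. (cmod (coord x l))\<^sup>2)"
    by (rule infsumI) (intro has_sum_of_real has_sum_infsum coord_summable)
  finally show ?thesis .
qed

instance
proof
  fix x y z :: ell2 and r :: real
  show "sgn x = x /\<^sub>R norm x" by (simp add: sgn_ell2_def)
  show "dist x y = norm (x - y)" by (simp add: dist_ell2_def)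
  show "(uniformity :: (ell2 \<times> ell2) filter) = (INF e\<in>{0<..}. principal {(x, y). dist x y < e})"
    by (simp add: uniformity_ell2_def)
  show "inner x y = inner y x" by (metis cinner_commute cnj.sel(1) inner_ell2_def)
  show "inner (x + y) z = inner x z + inner y z" by (simp add: inner_ell2_def cinner_add_left)
  show "inner (r *\<^sub>R x) y = r * inner x y"
  proof -
    have "cinner (r *\<^sub>R x) y = (\<Sum>\<^sub>\<infinity>l. of_real r * (cnj (coord x l) * coord y l))"
      by (simp add: cinner_def coord_scaleR scaleR_conv_of_real mult.assoc)
    also have "\<dots> = of_real r * cinner x y"
      unfolding cinner_def by (intro infsum_cmult_right cinner_summable)
    finally show ?thesis by (simp add: inner_ell2_def)
  qed
  show "0 \<le> inner x x" by (simp add: inner_ell2_def cinner_self infsum_nonneg)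
  show "inner x x = 0 \<longleftrightarrow> x = 0"
  proof
    assume "inner x x = 0"
    then have "(\<Sum>\<^sub>\<infinity>l. (cmod (coord x l))\<^sup>2) \<le> 0" by (simp add: inner_ell2_def cinner_self)
    then have "(cmod (coord x l))\<^sup>2 = 0" for l
      using nonneg_infsum_le_0D[OF _ coord_summable, of x l] by simp
    then show "x = 0" by (intro ell2_eqI) (simp add: coord_0)
  qed (simp add: inner_ell2_def cinner_self coord_0)
  show "norm x = sqrt (inner x x)" by (simp add: norm_ell2_def)
qed (simp add: open_ell2_def)

end

lemma norm_ell2_sq: "(norm x)\<^sup>2 = (\<Sum>\<^sub>\<infinity>l. (cmod (coord x l))\<^sup>2)"
  by (simp add: power2_norm_eq_inner inner_ell2_def cinner_self)

lemma coord_cscale [simp]: "coord (cscale c x) l = c * coord x l"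
  unfolding cscale_def by (subst Abs_ell2_inverse) (auto intro!: sqs_mult coord_summable)

declare coord_0 [simp] coord_add [simp] coord_uminus [simp] coord_scaleR [simp]

lemma coord_diff [simp]: "coord (x - y) l = coord x l - coord y l"
  using coord_add[of x "-y" l] by (simp del: coord_add)

lemma coord_sum [simp]: "coord (sum f A) l = (\<Sum>a\<in>A. coord (f a) l)"
  by (induction A rule: infinite_finite_induct) auto

lemma cmod_coord_le: "cmod (coord x l) \<le> norm x"
proof -
  have "(cmod (coord x l))\<^sup>2 \<le> (norm x)\<^sup>2"
    unfolding norm_ell2_sq using finite_sum_le_infsum[OF coord_summable, of "{l}" x] by simp
  then show ?thesis by (rule power2_le_imp_le) simp
qed

interpretation cvs: vector_space cscale
  by unfold_locales (auto intro!: ell2_eqI simp: distrib_left distrib_right)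

definition E :: "int \<Rightarrow> ell2" where
  "E k = Abs_ell2 (\<lambda>l. if l = k then 1 else 0)"

lemma coord_E [simp]: "coord (E k) l = (if l = k then 1 else 0)"
proof -
  have "(\<lambda>l. (cmod (if l = k then 1 else 0))\<^sup>2) summable_on UNIV"
    by (rule finite_nonzero_values_imp_summable_on) simp
  then show ?thesis by (simp add: E_def Abs_ell2_inverse)
qed

lemma cinner_E [simp]: "cinner (E k) x = coord x k"
proof -
  have "cinner (E k) x = (\<Sum>\<^sub>\<infinity>l\<in>{k}. cnj (coord (E k) l) * coord x l)"
    unfolding cinner_def by (rule infsum_cong_neutral) auto
  then show ?thesis by simp
qed


section \<open>Operators\<close>

text \<open>
  Bounded operators are elements of \<open>ell2 \<Rightarrow>\<^sub>L ell2\<close> (with the operator norm); since these are only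
  required to be real-linear, complex linearity is a separate condition.
\<close>

abbreviation clinear :: "(ell2 \<Rightarrow> ell2) \<Rightarrow> bool" where
  "clinear \<equiv> Vector_Spaces.linear cscale cscale"

text \<open>
  \<open>diag b\<close> is the operator $b(\mathbb L)$ with \<open>b\<close> possibly unbounded; it is meaningful
  at those \<open>x\<close> for which \<open>b \<cdot> x\<close> is square-summable, in particular on finitely supported \<open>x\<close>.
\<close>

definition diag :: "(int \<Rightarrow> complex) \<Rightarrow> ell2 \<Rightarrow> ell2" where
  "diag b x = Abs_ell2 (\<lambda>l. b l * coord x l)"

definition diag_op :: "(int \<Rightarrow> complex) \<Rightarrow> ell2 \<Rightarrow>\<^sub>L ell2" where
  "diag_op b = Blinfun (diag b)"

definition scal :: "complex \<Rightarrow> ell2 \<Rightarrow>\<^sub>L ell2" where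
  "scal c = diag_op (\<lambda>_. c)"

text \<open>\<open>Vpow n\<close> is \<open>V\<^sup>n\<close> for \<open>n\<close> any integer, that is \<open>E l \<mapsto> E (l + n)\<close>.\<close>

definition Vpow :: "int \<Rightarrow> ell2 \<Rightarrow>\<^sub>L ell2" where
  "Vpow n = Blinfun (\<lambda>x. Abs_ell2 (\<lambda>l. coord x (l - n)))"

definition V :: "ell2 \<Rightarrow>\<^sub>L ell2" where
  "V = Vpow 1"

definition is_adjoint :: "(ell2 \<Rightarrow>\<^sub>L ell2) \<Rightarrow> (ell2 \<Rightarrow>\<^sub>L ell2) \<Rightarrow> bool" where
  "is_adjoint A B \<longleftrightarrow> (\<forall>x y. cinner (A x) y = cinner x (B y))"

definition is_unitary :: "(ell2 \<Rightarrow>\<^sub>L ell2) \<Rightarrow> bool" where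
  "is_unitary U \<longleftrightarrow> clinear U \<and> surj (blinfun_apply U) \<and> (\<forall>x y. cinner (U x) (U y) = cinner x y)"

lemma coord_diag_fin:
  assumes "finite {l. coord x l \<noteq> 0}"
  shows "coord (diag b x) l = b l * coord x l"
proof -
  have "{l. (cmod (b l * coord x l))\<^sup>2 \<noteq> 0} \<subseteq> {l. coord x l \<noteq> 0}" by auto
  then have "(\<lambda>l. (cmod (b l * coord x l))\<^sup>2) summable_on UNIV"
    using assms by (intro finite_nonzero_values_imp_summable_on) (auto intro: finite_subset)
  then show ?thesis by (simp add: diag_def Abs_ell2_inverse)
qed

lemma coord_diag_bounded:
  assumes "\<And>l. cmod (b l) \<le> K"
  shows "coord (diag b x) l = b l * coord x l"
  unfolding diag_def by (subst Abs_ell2_inverse) (auto intro!: sqs_mult coord_summable assms)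

lemma bounded_linear_diag:
  assumes "\<And>l. cmod (b l) \<le> K"
  shows "bounded_linear (diag b)"
proof (rule bounded_linear_intro[where K = K])
  note c = coord_diag_bounded[of b K, OF assms]
  fix x y :: ell2 and r :: real
  show "diag b (x + y) = diag b x + diag b y" by (rule ell2_eqI) (simp add: c algebra_simps)
  show "diag b (r *\<^sub>R x) = r *\<^sub>R diag b x" by (rule ell2_eqI) (simp add: c)
  have K: "0 \<le> K" using order_trans[OF norm_ge_zero assms[of 0]] .
  have "(norm (diag b x))\<^sup>2 \<le> (\<Sum>\<^sub>\<infinity>l. K\<^sup>2 * (cmod (coord x l))\<^sup>2)"
    unfolding norm_ell2_sq
  proof (rule infsum_mono[OF coord_summable])
    show "(\<lambda>l. K\<^sup>2 * (cmod (coord x l))\<^sup>2) summable_on UNIV"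
      by (intro summable_on_cmult_right coord_summable)
    fix l show "(cmod (coord (diag b x) l))\<^sup>2 \<le> K\<^sup>2 * (cmod (coord x l))\<^sup>2"
      by (simp add: c norm_mult power_mult_distrib assms mult_right_mono power_mono)
  qed
  also have "\<dots> = K\<^sup>2 * (norm x)\<^sup>2"
    unfolding norm_ell2_sq by (intro infsum_cmult_right coord_summable)
  finally have "(norm (diag b x))\<^sup>2 \<le> (norm x * K)\<^sup>2" by (simp add: power_mult_distrib mult.commute)
  then show "norm (diag b x) \<le> norm x * K" by (rule power2_le_imp_le) (simp add: K)
qed

lemma coord_diag_op:
  assumes "\<And>l. cmod (b l) \<le> K"
  shows "coord (diag_op b x) l = b l * coord x l"
  unfolding diag_op_def
  by (simp add: bounded_linear_Blinfun_apply[OF bounded_linear_diag[of b K, OF assms]]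
      coord_diag_bounded[of b K, OF assms])

lemma coord_scal [simp]: "coord (scal c x) l = c * coord x l"
  unfolding scal_def by (rule coord_diag_op[where K = "cmod c"]) simp

lemma scal_apply: "scal c x = cscale c x"
  by (rule ell2_eqI) simp

lemma coord_Vpow [simp]: "coord (Vpow n x) l = coord x (l - n)"
proof -
  define f where "f x = Abs_ell2 (\<lambda>l. coord x (l - n))" for x
  have c: "coord (f x) l = coord x (l - n)" for x l
    unfolding f_def by (subst Abs_ell2_inverse) (auto intro!: sqs_shift coord_summable)
  have "bounded_linear f"
  proof (rule bounded_linear_intro[where K = 1])
    fix x y :: ell2 and r :: real
    show "f (x + y) = f x + f y" by (rule ell2_eqI) (simp add: c)
    show "f (r *\<^sub>R x) = r *\<^sub>R f x" by (rule ell2_eqI) (simp add: c)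
    have "(norm (f x))\<^sup>2 = (norm x)\<^sup>2"
      unfolding norm_ell2_sq c
      by (rule infsum_reindex_bij_betw[OF bij_shift, of "\<lambda>l. (cmod (coord x l))\<^sup>2"])
    then show "norm (f x) \<le> norm x * 1" by simp
  qed
  then show ?thesis
    unfolding Vpow_def f_def[symmetric] by (simp add: bounded_linear_Blinfun_apply c)
qed

lemma V_E: "V (E l) = E (l + 1)"
  by (rule ell2_eqI) (auto simp: V_def)

lemma Vpow_0: "Vpow 0 = id_blinfun"
  by (rule blinfun_eqI, rule ell2_eqI) simp

lemma Vpow_add: "Vpow (m + n) = Vpow m o\<^sub>L Vpow n"
  by (rule blinfun_eqI, rule ell2_eqI) (simp add: algebra_simps)


section \<open>Bunce-Deddens algebras\<close>

definition Bdiag_alg :: "supernatural \<Rightarrow> (ell2 \<Rightarrow>\<^sub>L ell2) set" where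
  "Bdiag_alg N = {diag_op b | b. \<exists>j. sn_dvd j N \<and> (\<forall>l. b (l + int j) = b l)}"

definition cstar_subalgebra :: "(ell2 \<Rightarrow>\<^sub>L ell2) set \<Rightarrow> bool" where
  "cstar_subalgebra A \<longleftrightarrow>
     (\<forall>a\<in>A. clinear a) \<and> closed A \<and> 0 \<in> A \<and>
     (\<forall>a\<in>A. \<forall>b\<in>A. a + b \<in> A) \<and> (\<forall>c. \<forall>a\<in>A. scal c o\<^sub>L a \<in> A) \<and>
     (\<forall>a\<in>A. \<forall>b\<in>A. a o\<^sub>L b \<in> A) \<and> (\<forall>a\<in>A. \<forall>b. is_adjoint a b \<longrightarrow> b \<in> A)"

definition cstar_generated :: "(ell2 \<Rightarrow>\<^sub>L ell2) set \<Rightarrow> (ell2 \<Rightarrow>\<^sub>L ell2) set" where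
  "cstar_generated S = \<Inter>{A. cstar_subalgebra A \<and> S \<subseteq> A}"

definition BD :: "supernatural \<Rightarrow> (ell2 \<Rightarrow>\<^sub>L ell2) set" where
  "BD N = cstar_generated (insert V (Bdiag_alg N))"

definition BD_alg :: "supernatural \<Rightarrow> (ell2 \<Rightarrow>\<^sub>L ell2) set" where
  "BD_alg N = {(\<Sum>n\<in>F. Vpow n o\<^sub>L B n) | F B. finite F \<and> (\<forall>n\<in>F. B n \<in> Bdiag_alg N)}"

definition rho :: "real \<Rightarrow> (ell2 \<Rightarrow>\<^sub>L ell2) \<Rightarrow> (ell2 \<Rightarrow>\<^sub>L ell2)" where
  "rho \<theta> b = diag_op (\<lambda>l. cis (\<theta> * l)) o\<^sub>L b o\<^sub>L diag_op (\<lambda>l. cis (- \<theta> * l))"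

definition derivation :: "supernatural \<Rightarrow> ((ell2 \<Rightarrow>\<^sub>L ell2) \<Rightarrow> (ell2 \<Rightarrow>\<^sub>L ell2)) \<Rightarrow> bool" where
  "derivation N \<delta> \<longleftrightarrow>
     (\<forall>a\<in>BD_alg N. \<delta> a \<in> BD N) \<and>
     (\<forall>a\<in>BD_alg N. \<forall>b\<in>BD_alg N. \<delta> (a + b) = \<delta> a + \<delta> b) \<and>
     (\<forall>c. \<forall>a\<in>BD_alg N. \<delta> (scal c o\<^sub>L a) = scal c o\<^sub>L \<delta> a) \<and>
     (\<forall>a\<in>BD_alg N. \<forall>b\<in>BD_alg N. \<delta> (a o\<^sub>L b) = (\<delta> a o\<^sub>L b) + (a o\<^sub>L \<delta> b))"

text \<open>The inverse of \<open>rho \<theta>\<close> is \<open>rho (- \<theta>)\<close>, see \<open>rho_inverse\<close> below.\<close>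

definition covariant_derivation ::
    "supernatural \<Rightarrow> int \<Rightarrow> ((ell2 \<Rightarrow>\<^sub>L ell2) \<Rightarrow> (ell2 \<Rightarrow>\<^sub>L ell2)) \<Rightarrow> bool" where
  "covariant_derivation N n \<delta> \<longleftrightarrow> derivation N \<delta> \<and>
     (\<forall>\<theta>\<in>{0..<2 * pi}. \<forall>b\<in>BD_alg N. rho (- \<theta>) (\<delta> (rho \<theta> b)) = scal (cis (- real_of_int n * \<theta>)) o\<^sub>L \<delta> b)"

text \<open>\<open>\<delta> b\<close> is the commutator of $V^n\eta(\mathbb L)$ and \<open>b\<close>, computed on the linear span of the basis.\<close>

definition implemented_by ::
    "supernatural \<Rightarrow> int \<Rightarrow> ((ell2 \<Rightarrow>\<^sub>L ell2) \<Rightarrow> (ell2 \<Rightarrow>\<^sub>L ell2)) \<Rightarrow> (int \<Rightarrow> complex) \<Rightarrow> bool" where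
  "implemented_by N n \<delta> \<eta> \<longleftrightarrow>
     (\<forall>b\<in>BD_alg N. \<forall>x\<in>cvs.span (range E). \<delta> b x = Vpow n (diag \<eta> (b x)) - b (Vpow n (diag \<eta> x)))"


section \<open>The state and its GNS representation\<close>

definition cond_exp :: "(ell2 \<Rightarrow>\<^sub>L ell2) \<Rightarrow> (ell2 \<Rightarrow>\<^sub>L ell2)" where
  "cond_exp b = (1 / (2 * pi)) *\<^sub>R integral {0..2 * pi} (\<lambda>\<theta>. rho \<theta> b)"

definition tau0 :: "(ell2 \<Rightarrow>\<^sub>L ell2) \<Rightarrow> complex" where
  "tau0 b = cinner (E 0) (cond_exp b (E 0))"

text \<open>
  The class \<open>[b]\<close> of \<open>b\<close> in the GNS space: for $b = \sum_n V^n b_n(\mathbb L)$ one has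
  $b_n(0) = \tau_0(V^{-n}b)$. See \<open>gns_class_sum\<close>, \<open>gns_class_id\<close>, \<open>gns_class_inner\<close>
  and \<open>gns_class_mult\<close> for the identification of the GNS space with \<open>ell2\<close>, of the cyclic vector
  with \<open>E 0\<close> and of the GNS representation with the defining one, \<open>gns_domain_eq\<close> for its domain, and
  \<open>gns_rotation_eq\<close> for the existence and uniqueness of the unitaries defined below.
\<close>

definition gns_class :: "(ell2 \<Rightarrow>\<^sub>L ell2) \<Rightarrow> ell2" where
  "gns_class b = Abs_ell2 (\<lambda>n. tau0 (Vpow (- n) o\<^sub>L b))"

definition gns_domain :: "supernatural \<Rightarrow> ell2 set" where
  "gns_domain N = {blinfun_apply a (gns_class id_blinfun) | a. a \<in> BD_alg N}"

definition gns_rotation :: "supernatural \<Rightarrow> real \<Rightarrow> (ell2 \<Rightarrow>\<^sub>L ell2)" where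
  "gns_rotation N \<theta> =
     (THE U. is_unitary U \<and> (\<forall>b\<in>BD_alg N. U (gns_class b) = gns_class (rho \<theta> b)))"

text \<open>
  The implementation is a partial operator: only the values of \<open>D\<close> on \<open>gns_domain N\<close> matter.
\<close>

definition covariant_implementation ::
    "supernatural \<Rightarrow> int \<Rightarrow> ((ell2 \<Rightarrow>\<^sub>L ell2) \<Rightarrow> (ell2 \<Rightarrow>\<^sub>L ell2)) \<Rightarrow> (ell2 \<Rightarrow> ell2) \<Rightarrow> bool" where
  "covariant_implementation N n \<delta> D \<longleftrightarrow>
     (\<forall>x\<in>gns_domain N. \<forall>y\<in>gns_domain N. D (x + y) = D x + D y) \<and>
     (\<forall>c. \<forall>x\<in>gns_domain N. D (cscale c x) = cscale c (D x)) \<and>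
     (\<forall>b\<in>BD_alg N. \<forall>x\<in>gns_domain N. D (blinfun_apply b x) - blinfun_apply b (D x) = \<delta> b x) \<and>
     (\<forall>\<theta>. \<forall>x\<in>gns_domain N.
        blinfun_apply (gns_rotation N \<theta>) (D (inv (blinfun_apply (gns_rotation N \<theta>)) x)) =
        cscale (cis (real_of_int n * \<theta>)) (D x))"


section \<open>Compact parametrices\<close>

text \<open>Unbounded operators are represented by their graphs.\<close>

definition op_graph :: "(ell2 \<Rightarrow> ell2) \<Rightarrow> ell2 set \<Rightarrow> (ell2 \<times> ell2) set" where
  "op_graph D S = {(x, D x) | x. x \<in> S}"

definition adj_graph :: "(ell2 \<times> ell2) set \<Rightarrow> (ell2 \<times> ell2) set" where
  "adj_graph G = {(y, z). \<forall>(x, w)\<in>G. cinner w y = cinner x z}"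

definition one_plus :: "(ell2 \<times> ell2) set \<Rightarrow> (ell2 \<times> ell2) set" where
  "one_plus G = {(x, x + y) | x y. (x, y) \<in> G}"

text \<open>
  For a positive self-adjoint \<open>A\<close> with bounded inverse, given by its graph, \<open>S\<close> is $A^{-1/2}$, that is
  the bounded positive square root of $A^{-1}$.
\<close>

definition is_inv_sqrt :: "(ell2 \<times> ell2) set \<Rightarrow> (ell2 \<Rightarrow>\<^sub>L ell2) \<Rightarrow> bool" where
  "is_inv_sqrt A S \<longleftrightarrow> clinear S \<and> (\<forall>x. cinner x (S x) \<in> \<real> \<and> 0 \<le> Re (cinner x (S x))) \<and>
     op_graph (\<lambda>x. S (S x)) UNIV = A\<inverse>"

definition compact_op :: "(ell2 \<Rightarrow>\<^sub>L ell2) \<Rightarrow> bool" where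
  "compact_op S \<longleftrightarrow> compact (closure (blinfun_apply S ` cball 0 1))"

text \<open>
  With \<open>G\<close> the graph of the closure of \<open>D\<close>, the graph of $D^*D$ is \<open>G O adj_graph G\<close>
  (relational composition applies its left factor first).
\<close>

definition compact_parametrices :: "(ell2 \<Rightarrow> ell2) \<Rightarrow> ell2 set \<Rightarrow> bool" where
  "compact_parametrices D S \<longleftrightarrow> (let G = closure (op_graph D S) in
     (\<exists>R. is_inv_sqrt (one_plus (G O adj_graph G)) R \<and> compact_op R) \<and>
     (\<exists>R. is_inv_sqrt (one_plus (adj_graph G O G)) R \<and> compact_op R))"

definition bounded_on_domain :: "(ell2 \<Rightarrow> ell2) \<Rightarrow> ell2 set \<Rightarrow> bool" where
  "bounded_on_domain D S \<longleftrightarrow> (\<exists>C. \<forall>x\<in>S. norm (D x) \<le> C * norm x)"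


section \<open>Consistency of the GNS identification\<close>

lemma periodic_bounded:
  fixes b :: "int \<Rightarrow> complex"
  assumes "0 < j" "\<And>l. b (l + int j) = b l"
  obtains K where "\<And>l. cmod (b l) \<le> K"
proof -
  have up: "b (l + int j * int k) = b l" for l k
    by (induction k) (use assms(2)[of "l + int j * int k" for k] in \<open>auto simp: algebra_simps\<close>)
  have m: "b l = b (l mod int j)" for l
  proof (cases "0 \<le> l div int j")
    case True
    then have "b (l mod int j + int j * int (nat (l div int j))) = b (l mod int j)" by (intro up)
    with True show ?thesis by simp
  next
    case False
    then have "b (l + int j * int (nat (- (l div int j)))) = b l" by (intro up)
    moreover have "l + int j * int (nat (- (l div int j))) = l mod int j"
      using False by (simp add: minus_div_mult_eq_mod[symmetric] algebra_simps)
    ultimately show ?thesis by simp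
  qed
  have "cmod (b l) \<le> Max ((\<lambda>l. cmod (b l)) ` {0..<int j})" for l
    using assms(1) by (subst m, intro Max_ge) auto
  then show ?thesis using that by blast
qed

lemma Bdiag_algE:
  assumes "B \<in> Bdiag_alg N"
  obtains b j where "sn_dvd j N" "\<And>l. b (l + int j) = b l" "\<And>x l. coord (B x) l = b l * coord x l"
proof -
  obtain b j where b: "B = diag_op b" "sn_dvd j N" "\<And>l. b (l + int j) = b l"
    using assms by (auto simp: Bdiag_alg_def)
  moreover obtain K where "\<And>l. cmod (b l) \<le> K"
    using periodic_bounded[of j b] b by (auto simp: sn_dvd_def)
  ultimately show ?thesis using that coord_diag_op by blast
qed

lemma Bdiag_algI:
  assumes "sn_dvd j N" "\<And>l. b (l + int j) = b l" "\<And>x l. coord (blinfun_apply B x) l = b l * coord x l"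
  shows "B \<in> Bdiag_alg N"
proof -
  obtain K where "\<And>l. cmod (b l) \<le> K"
    using periodic_bounded[of j b] assms by (auto simp: sn_dvd_def)
  then have "B = diag_op b"
    by (intro blinfun_eqI ell2_eqI) (simp add: assms(3) coord_diag_op[where K = K])
  then show ?thesis using assms(1,2) by (auto simp: Bdiag_alg_def)
qed

lemma sn_dvd_1: "sn_dvd 1 N"
  by (auto simp: sn_dvd_def zero_enat_def[symmetric])

lemma sn_dvd_lcm:
  assumes "sn_dvd i N" "sn_dvd j N" shows "sn_dvd (lcm i j) N"
proof -
  have "multiplicity p (lcm i j) = max (multiplicity p i) (multiplicity p j)" if "prime p" for p
    using assms that by (simp add: multiplicity_lcm sn_dvd_def)
  then show ?thesis using assms by (auto simp: sn_dvd_def lcm_pos_nat max_def)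
qed

lemma scal_1: "scal 1 = id_blinfun"
  by (intro blinfun_eqI ell2_eqI) simp

lemma id_blinfun_compose [simp]: "id_blinfun o\<^sub>L a = a" "a o\<^sub>L id_blinfun = a"
  by (simp_all add: blinfun_eqI)

lemma scal_Bdiag: "scal c \<in> Bdiag_alg N"
  by (rule Bdiag_algI[OF sn_dvd_1, of "\<lambda>_. c"]) auto

lemma periodic_dvd:
  fixes b :: "int \<Rightarrow> complex"
  assumes "\<And>l. b (l + int j) = b l" "j dvd m"
  shows "b (l + int m) = b l"
proof -
  obtain k where "m = j * k" using assms(2) by blast
  moreover have "b (l + int j * int k) = b l" 
    by (induction k) (use assms(1)[of "l + int j * int k" for k] in \<open>auto simp: algebra_simps\<close>)
  ultimately show ?thesis by simp
qed

lemma Bdiag_add: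
  assumes "A \<in> Bdiag_alg N" "B \<in> Bdiag_alg N"
  shows "A + B \<in> Bdiag_alg N"
proof -
  obtain a i b j where ij: "sn_dvd i N" "sn_dvd j N" 
    and a: "\<And>l. a (l + int i) = a l" "\<And>x l. coord (A x) l = a l * coord x l"
    and b: "\<And>l. b (l + int j) = b l" "\<And>x l. coord (B x) l = b l * coord x l"
    using assms by (elim Bdiag_algE) blast
  show ?thesis
  proof (rule Bdiag_algI[OF sn_dvd_lcm[OF ij], of "\<lambda>l. a l + b l"])
    show "a (l + int (lcm i j)) + b (l + int (lcm i j)) = a l + b l" for l
      using periodic_dvd[where j = i and b = a and l = l, OF a(1) dvd_lcm1[of i j]]
        periodic_dvd[where j = j and b = b and l = l, OF b(1) dvd_lcm2[of j i]]
      by simp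
  qed (simp add: a b blinfun.add_left distrib_right)
qed

lemma Bdiag_mult_shift:
  assumes "A \<in> Bdiag_alg N" "B \<in> Bdiag_alg N"
  shows "Vpow (- k) o\<^sub>L A o\<^sub>L Vpow k o\<^sub>L B \<in> Bdiag_alg N"
proof -
  obtain a i b j where ij: "sn_dvd i N" "sn_dvd j N" 
    and a: "\<And>l. a (l + int i) = a l" "\<And>x l. coord (A x) l = a l * coord x l"
    and b: "\<And>l. b (l + int j) = b l" "\<And>x l. coord (B x) l = b l * coord x l"
    using assms by (elim Bdiag_algE) blast
  show ?thesis
  proof (rule Bdiag_algI[OF sn_dvd_lcm[OF ij], of "\<lambda>l. a (l + k) * b l"])
    show "a (l + int (lcm i j) + k) * b (l + int (lcm i j)) = a (l + k) * b l" for l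
      using periodic_dvd[where j = i and b = a and l = "l + k", OF a(1) dvd_lcm1[of i j]] 
        periodic_dvd[where j = j and b = b, OF b(1) dvd_lcm2[of j i]]
      by (simp add: algebra_simps)
  qed (simp add: a b)
qed

lemma BD_alg_monom: "B \<in> Bdiag_alg N \<Longrightarrow> Vpow n o\<^sub>L B \<in> BD_alg N"
  unfolding BD_alg_def by (rule CollectI, rule exI[of _ "{n}"], rule exI[of _ "\<lambda>_. B"]) simp

lemma Bdiag_0: "0 \<in> Bdiag_alg N"
  by (rule Bdiag_algI[OF sn_dvd_1, of "\<lambda>_. 0"]) auto

lemma BD_alg_add:
  assumes "a \<in> BD_alg N" "b \<in> BD_alg N" shows "a + b \<in> BD_alg N"
proof -
  obtain F A G B where F: "finite F" "\<forall>n\<in>F. A n \<in> Bdiag_alg N" "a = (\<Sum>n\<in>F. Vpow n o\<^sub>L A n)"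
    and G: "finite G" "\<forall>n\<in>G. B n \<in> Bdiag_alg N" "b = (\<Sum>n\<in>G. Vpow n o\<^sub>L B n)"
    using assms by (auto simp: BD_alg_def)
  let ?A = "\<lambda>n. if n \<in> F then A n else 0" and ?B = "\<lambda>n. if n \<in> G then B n else 0"
  have "a = (\<Sum>n\<in>F \<union> G. Vpow n o\<^sub>L ?A n)" unfolding F(3)
    using F G by (intro sum.mono_neutral_cong_left) auto
  moreover have "b = (\<Sum>n\<in>F \<union> G. Vpow n o\<^sub>L ?B n)" unfolding G(3)
    using F G by (intro sum.mono_neutral_cong_left) auto
  ultimately have "a + b = (\<Sum>n\<in>F \<union> G. Vpow n o\<^sub>L (?A n + ?B n))"
    by (simp only: sum.distrib[symmetric] bounded_bilinear.add_right[OF bounded_bilinear_blinfun_compose])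
  moreover have "\<forall>n\<in>F \<union> G. ?A n + ?B n \<in> Bdiag_alg N"
    using F G by (auto intro!: Bdiag_add Bdiag_0)
  ultimately show ?thesis using F(1) G(1) unfolding BD_alg_def
    by (intro CollectI exI[of _ "F \<union> G"] exI[of _ "\<lambda>n. ?A n + ?B n"]) simp
qed

lemma BD_alg_0: "0 \<in> BD_alg N"
  unfolding BD_alg_def by (rule CollectI, rule exI[of _ "{}"]) simp

lemma BD_alg_sum: "(\<And>i. i \<in> I \<Longrightarrow> f i \<in> BD_alg N) \<Longrightarrow> sum f I \<in> BD_alg N"
  by (induction I rule: infinite_finite_induct) (auto intro: BD_alg_add BD_alg_0)

lemma blinfun_sum_apply: "blinfun_apply (sum f I) x = (\<Sum>i\<in>I. blinfun_apply (f i) x)"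
  by (induction I rule: infinite_finite_induct) (auto simp: blinfun.add_left)

lemma BD_alg_mult:
  assumes "a \<in> BD_alg N" "b \<in> BD_alg N" shows "a o\<^sub>L b \<in> BD_alg N"
proof -
  obtain F A G B where F: "finite F" "\<forall>n\<in>F. A n \<in> Bdiag_alg N" "a = (\<Sum>n\<in>F. Vpow n o\<^sub>L A n)"
    and G: "finite G" "\<forall>n\<in>G. B n \<in> Bdiag_alg N" "b = (\<Sum>n\<in>G. Vpow n o\<^sub>L B n)"
    using assms by (auto simp: BD_alg_def)
  have "a o\<^sub>L b = (\<Sum>m\<in>G. \<Sum>n\<in>F. Vpow (n + m) o\<^sub>L (Vpow (- m) o\<^sub>L A n o\<^sub>L Vpow m o\<^sub>L B m))"
    by (intro blinfun_eqI ell2_eqI)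
      (simp add: F(3) G(3) blinfun_sum_apply blinfun.sum_right algebra_simps)
  also have "\<dots> \<in> BD_alg N"
    using F G by (intro BD_alg_sum BD_alg_monom Bdiag_mult_shift) auto
  finally show ?thesis .
qed

lemma cinner_add_right: "cinner z (x + y) = cinner z x + cinner z y"
  by (metis cinner_commute cinner_add_left complex_cnj_add)

lemma is_adjoint_unique: "is_adjoint a b \<Longrightarrow> is_adjoint a b' \<Longrightarrow> b = b'"
  by (intro blinfun_eqI ell2_eqI) (metis cinner_E is_adjoint_def)

lemma is_adjoint_add: "is_adjoint a a' \<Longrightarrow> is_adjoint b b' \<Longrightarrow> is_adjoint (a + b) (a' + b')"
  by (simp add: is_adjoint_def blinfun.add_left cinner_add_left cinner_add_right)

lemma is_adjoint_0: "is_adjoint 0 0"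
  by (simp add: is_adjoint_def cinner_def)

lemma is_adjoint_sum: "(\<And>i. i \<in> I \<Longrightarrow> is_adjoint (f i) (g i)) \<Longrightarrow> is_adjoint (sum f I) (sum g I)"
  by (induction I rule: infinite_finite_induct) (auto intro: is_adjoint_add is_adjoint_0)

lemma is_adjoint_compose: "is_adjoint a a' \<Longrightarrow> is_adjoint b b' \<Longrightarrow> is_adjoint (a o\<^sub>L b) (b' o\<^sub>L a')"
  by (simp add: is_adjoint_def)

lemma is_adjoint_Vpow: "is_adjoint (Vpow n) (Vpow (- n))"
proof -
  have "cinner (Vpow n x) y = cinner x (Vpow (- n) y)" for x y
    unfolding cinner_def
    using infsum_reindex_bij_betw[OF bij_shift[of n], of "\<lambda>l. cnj (coord x l) * coord y (l + n)"] by simp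
  then show ?thesis by (simp add: is_adjoint_def)
qed

lemma Bdiag_adjoint:
  assumes "B \<in> Bdiag_alg N"
  obtains B' where "B' \<in> Bdiag_alg N" "is_adjoint B B'"
proof -
  obtain b j where b: "sn_dvd j N" "\<And>l. b (l + int j) = b l" "\<And>x l. coord (B x) l = b l * coord x l"
    using assms by (elim Bdiag_algE) blast
  obtain K where K: "\<And>l. cmod (b l) \<le> K"
    using periodic_bounded[of j b] b by (auto simp: sn_dvd_def)
  have c: "coord (diag_op (\<lambda>l. cnj (b l)) x) l = cnj (b l) * coord x l" for x l
    by (rule coord_diag_op[where K = K]) (simp add: K)
  show ?thesis
  proof (rule that)
    show "diag_op (\<lambda>l. cnj (b l)) \<in> Bdiag_alg N"
      by (rule Bdiag_algI[OF b(1) _ c]) (simp add: b(2))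
    show "is_adjoint B (diag_op (\<lambda>l. cnj (b l)))"
      by (simp add: is_adjoint_def cinner_def b(3) c mult_ac)
  qed
qed

lemma BD_alg_adjoint:
  assumes "a \<in> BD_alg N" "is_adjoint a a'" shows "a' \<in> BD_alg N"
proof -
  obtain F A where F: "finite F" "\<forall>n\<in>F. A n \<in> Bdiag_alg N" "a = (\<Sum>n\<in>F. Vpow n o\<^sub>L A n)"
    using assms by (auto simp: BD_alg_def)
  have "\<forall>n\<in>F. \<exists>B. B \<in> Bdiag_alg N \<and> is_adjoint (A n) B" using F(2) Bdiag_adjoint by metis
  then obtain B where B: "\<And>n. n \<in> F \<Longrightarrow> B n \<in> Bdiag_alg N \<and> is_adjoint (A n) (B n)" by metis
  have "is_adjoint a (\<Sum>n\<in>F. B n o\<^sub>L Vpow (- n))"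
    unfolding F(3) using B by (intro is_adjoint_sum is_adjoint_compose is_adjoint_Vpow) auto
  then have "a' = (\<Sum>n\<in>F. B n o\<^sub>L Vpow (- n))" using assms(2) is_adjoint_unique by blast
  moreover have "B n o\<^sub>L Vpow (- n) \<in> BD_alg N" if "n \<in> F" for n
  proof -
    have "Vpow 0 o\<^sub>L B n \<in> BD_alg N" "Vpow (- n) o\<^sub>L scal 1 \<in> BD_alg N"
      using B[OF that] by (auto intro: BD_alg_monom scal_Bdiag)
    from BD_alg_mult[OF this] show ?thesis
      by (simp add: scal_1 Vpow_0)
  qed
  ultimately show ?thesis by (auto intro: BD_alg_sum)
qed

lemma coord_rot [simp]: "coord (diag_op (\<lambda>l. cis (\<theta> * real_of_int l)) x) l = cis (\<theta> * real_of_int l) * coord x l"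
  by (rule coord_diag_op[where K = 1]) simp

lemma coord_rot' [simp]:
  "coord (diag_op (\<lambda>l. cis (- (\<theta> * real_of_int l))) x) l = cis (- (\<theta> * real_of_int l)) * coord x l"
  by (rule coord_diag_op[where K = 1]) simp

lemma rho_inverse: "rho (- \<theta>) (rho \<theta> b) = b" "rho \<theta> (rho (- \<theta>) b) = b"
proof -
  have *: "diag_op (\<lambda>l. cis (- (\<theta> * l))) (diag_op (\<lambda>l. cis (\<theta> * l)) x) = x"
    "diag_op (\<lambda>l. cis (\<theta> * l)) (diag_op (\<lambda>l. cis (- (\<theta> * l))) x) = x" for x \<theta>
    by (rule ell2_eqI; simp add: mult.assoc[symmetric] cis_mult)+
  show "rho (- \<theta>) (rho \<theta> b) = b" "rho \<theta> (rho (- \<theta>) b) = b"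
    by (rule blinfun_eqI; simp add: rho_def *)+
qed

lemma rho_monom:
  assumes "B \<in> Bdiag_alg N"
  shows "rho \<theta> (Vpow n o\<^sub>L B) = scal (cis (real_of_int n * \<theta>)) o\<^sub>L (Vpow n o\<^sub>L B)"
proof -
  obtain b j where b: "\<And>x l. coord (B x) l = b l * coord x l"
    using assms by (elim Bdiag_algE) blast
  have "cis (\<theta> * real_of_int l) * (u * (cis (- (\<theta> * real_of_int (l - n))) * v)) =
      cis (real_of_int n * \<theta>) * (u * v)" for l u v
  proof -
    have "cis (\<theta> * real_of_int l) * cis (- (\<theta> * real_of_int (l - n))) = cis (real_of_int n * \<theta>)"
      by (simp add: cis_mult algebra_simps)
    then show ?thesis by (metis mult.assoc mult.left_commute)
  qed
  then show ?thesis
    by (intro blinfun_eqI ell2_eqI) (simp only: rho_def b blinfun_apply_blinfun_compose coord_rot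
        coord_rot' coord_Vpow coord_scal mult_minus_left)
qed

lemma rho_sum: "rho \<theta> (sum f F) = (\<Sum>i\<in>F. rho \<theta> (f i))"
  by (intro blinfun_eqI) (simp add: rho_def blinfun_sum_apply blinfun.sum_right)

lemma rho_BD_alg: assumes "b \<in> BD_alg N" shows "rho \<theta> b \<in> BD_alg N"
proof -
  obtain F B where F: "finite F" "\<forall>n\<in>F. B n \<in> Bdiag_alg N" "b = (\<Sum>n\<in>F. Vpow n o\<^sub>L B n)"
    using assms by (auto simp: BD_alg_def)
  have "scal c \<in> BD_alg N" for c
    using BD_alg_monom[OF scal_Bdiag, of 0 c] by (simp add: Vpow_0)
  then show ?thesis using F(2)
    unfolding F(3) rho_sum
    by (intro BD_alg_sum) (metis rho_monom BD_alg_mult BD_alg_monom)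
qed

lemma has_integral_rot:
  "((\<lambda>\<theta>. scal (cis (real_of_int n * \<theta>)) o\<^sub>L A) has_integral (if n = 0 then (2 * pi) *\<^sub>R A else 0)) {0..2 * pi}"
proof (cases "n = 0")
  case True
  have "scal 1 o\<^sub>L A = A" by (intro blinfun_eqI ell2_eqI) simp
  then show ?thesis using True has_integral_const_real[of A 0 "2 * pi"] by simp
next
  case False
  let ?n = "of_int n :: real"
  have s0: "sin (?n * (2 * pi)) = 0" using sin_int_2pin[of n] by (simp add: mult_ac)
  have c1: "cos (?n * (2 * pi)) = 1" using cos_int_2pin[of n] by (simp add: mult_ac)
  have 1: "((\<lambda>\<theta>. cos (?n * \<theta>)) has_integral (sin (?n * (2 * pi)) / ?n - sin (?n * 0) / ?n)) {0..2 * pi}"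
    using False by (intro fundamental_theorem_of_calculus)
      (auto intro!: derivative_eq_intros simp: has_real_derivative_iff_has_vector_derivative[symmetric])
  have 2: "((\<lambda>\<theta>. sin (?n * \<theta>)) has_integral (- cos (?n * (2 * pi)) / ?n - - cos (?n * 0) / ?n)) {0..2 * pi}"
    using False by (intro fundamental_theorem_of_calculus)
      (auto intro!: derivative_eq_intros simp: has_real_derivative_iff_has_vector_derivative[symmetric])
  have eq: "scal (cis t) o\<^sub>L A = cos t *\<^sub>R A + sin t *\<^sub>R (scal \<i> o\<^sub>L A)" for t
    by (intro blinfun_eqI ell2_eqI)
      (simp add: blinfun.add_left blinfun.scaleR_left cis_conv_exp exp_Euler scaleR_conv_of_real cos_of_real sin_of_real algebra_simps)
  have "((\<lambda>\<theta>. cos (?n * \<theta>) *\<^sub>R A + sin (?n * \<theta>) *\<^sub>R (scal \<i> o\<^sub>L A)) has_integral (0 *\<^sub>R A + 0 *\<^sub>R (scal \<i> o\<^sub>L A))) {0..2 * pi}"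
    using 1 2 by (intro has_integral_add has_integral_scaleR_left) (simp_all add: s0 c1)
  then show ?thesis using False by (simp add: eq)
qed

lemma cond_exp_sum:
  assumes "finite F" "\<And>n. n \<in> F \<Longrightarrow> B n \<in> Bdiag_alg N"
  shows "cond_exp (\<Sum>n\<in>F. Vpow n o\<^sub>L B n) = (if 0 \<in> F then B 0 else 0)"
proof -
  have "((\<lambda>\<theta>. \<Sum>n\<in>F. scal (cis (real_of_int n * \<theta>)) o\<^sub>L (Vpow n o\<^sub>L B n)) has_integral
      (\<Sum>n\<in>F. if n = 0 then (2 * pi) *\<^sub>R (Vpow n o\<^sub>L B n) else 0)) {0..2 * pi}"
    by (intro has_integral_sum assms has_integral_rot)
  moreover have "(\<Sum>n\<in>F. if n = 0 then (2 * pi) *\<^sub>R (Vpow n o\<^sub>L B n) else 0) =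
      (if 0 \<in> F then (2 * pi) *\<^sub>R B 0 else 0)"
    using assms(1) by (simp add: sum.delta Vpow_0)
  moreover have "rho \<theta> (\<Sum>n\<in>F. Vpow n o\<^sub>L B n) = (\<Sum>n\<in>F. scal (cis (real_of_int n * \<theta>)) o\<^sub>L (Vpow n o\<^sub>L B n))" for \<theta>
    unfolding rho_sum by (intro sum.cong refl rho_monom[where N = N] assms(2))
  ultimately show ?thesis by (auto simp: cond_exp_def integral_unique)
qed

lemma tau0_eq:
  assumes "b \<in> BD_alg N" shows "tau0 b = coord (b (E 0)) 0"
proof -
  obtain F B where F: "finite F" "\<forall>n\<in>F. B n \<in> Bdiag_alg N" "b = (\<Sum>n\<in>F. Vpow n o\<^sub>L B n)"
    using assms by (auto simp: BD_alg_def)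
  have "coord ((Vpow n o\<^sub>L B n) (E 0)) 0 = (if n = 0 then coord (B 0 (E 0)) 0 else 0)" if "n \<in> F" for n
    using F(2) that by (auto elim!: Bdiag_algE)
  then have "coord (b (E 0)) 0 = (\<Sum>n\<in>F. if n = 0 then coord (B 0 (E 0)) 0 else 0)"
    unfolding F(3) blinfun_sum_apply coord_sum by (intro sum.cong) simp_all
  moreover have "cond_exp b = (if 0 \<in> F then B 0 else 0)"
    unfolding F(3) using F(1,2) by (intro cond_exp_sum) auto
  ultimately show ?thesis using F(1) by (simp add: tau0_def)
qed

lemma Vpow_BD_alg: "Vpow n \<in> BD_alg N"
proof -
  have "Vpow n o\<^sub>L scal 1 = Vpow n" by (intro blinfun_eqI ell2_eqI) simp
  then show ?thesis using BD_alg_monom[OF scal_Bdiag] by metis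
qed

lemma gns_class_eq:
  assumes "b \<in> BD_alg N" shows "gns_class b = b (E 0)"
proof -
  have "tau0 (Vpow (- n) o\<^sub>L b) = coord (b (E 0)) n" for n
    using tau0_eq[OF BD_alg_mult[OF Vpow_BD_alg assms], of "- n"] by simp
  then show ?thesis by (simp add: gns_class_def coord_inverse)
qed

lemma gns_class_sum:
  assumes "finite F" "\<And>n. n \<in> F \<Longrightarrow> diag_op (b n) \<in> Bdiag_alg N"
    and "\<And>n. n \<in> F \<Longrightarrow> \<exists>K. \<forall>l. cmod (b n l) \<le> K"
  shows "coord (gns_class (\<Sum>n\<in>F. Vpow n o\<^sub>L diag_op (b n))) k = (if k \<in> F then b k 0 else 0)"
proof -
  have *: "(\<Sum>n\<in>F. Vpow n o\<^sub>L diag_op (b n)) \<in> BD_alg N"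
    using assms by (intro BD_alg_sum BD_alg_monom) auto
  have "coord (diag_op (b n) (E 0)) (k - n) = (if n = k then b k 0 else 0)" if n: "n \<in> F" for n
  proof -
    obtain K where "\<And>l. cmod (b n l) \<le> K" using assms(3)[OF n] by blast
    from coord_diag_op[of "b n", OF this] show ?thesis by auto
  qed
  then show ?thesis
    using assms(1) by (simp add: gns_class_eq[OF *] blinfun_sum_apply sum.delta)
qed

lemma gns_class_id: "gns_class id_blinfun = E 0"
  using gns_class_eq[OF Vpow_BD_alg[of 0]] by (simp add: Vpow_0)

lemma gns_class_mult:
  "a \<in> BD_alg N \<Longrightarrow> b \<in> BD_alg N \<Longrightarrow> gns_class (a o\<^sub>L b) = a (gns_class b)"
  by (simp add: gns_class_eq[where N = N] BD_alg_mult)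

lemma gns_class_inner:
  assumes "a \<in> BD_alg N" "b \<in> BD_alg N" "is_adjoint a a'"
  shows "cinner (gns_class a) (gns_class b) = tau0 (a' o\<^sub>L b)"
proof -
  have "tau0 (a' o\<^sub>L b) = cinner (E 0) (a' (b (E 0)))"
    using tau0_eq[OF BD_alg_mult[OF BD_alg_adjoint[OF assms(1,3)] assms(2)]] by simp
  also have "\<dots> = cinner (a (E 0)) (b (E 0))"
    using assms(3) by (simp add: is_adjoint_def)
  finally show ?thesis using assms by (simp add: gns_class_eq)
qed

lemma gns_domain_eq: "gns_domain N = cvs.span (range E)"
proof
  show "gns_domain N \<subseteq> cvs.span (range E)"
  proof
    fix x assume "x \<in> gns_domain N"
    then obtain F B where F: "finite F" "\<forall>n\<in>F. B n \<in> Bdiag_alg N" "x = (\<Sum>n\<in>F. Vpow n o\<^sub>L B n) (E 0)"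
      by (auto simp: gns_domain_def gns_class_id BD_alg_def)
    have "(Vpow n o\<^sub>L B n) (E 0) \<in> cvs.span (range E)" if "n \<in> F" for n
    proof -
      have "B n \<in> Bdiag_alg N" using F(2) that by blast
      then obtain b j where "sn_dvd j N" "\<And>l. b (l + int j) = b l"
        and b: "\<And>x l. coord (B n x) l = b l * coord x l"
        by (rule Bdiag_algE) blast
      have "(Vpow n o\<^sub>L B n) (E 0) = cscale (b 0) (E n)" by (rule ell2_eqI) (auto simp: b)
      then show ?thesis by (simp add: cvs.span_scale cvs.span_base)
    qed
    then show "x \<in> cvs.span (range E)" unfolding F(3) blinfun_sum_apply by (rule cvs.span_sum)
  qed
  have "E n \<in> gns_domain N" for n
  proof -
    have "Vpow n (E 0) = E n" by (rule ell2_eqI) auto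
    then show ?thesis unfolding gns_domain_def gns_class_id
      by (intro CollectI exI[of _ "Vpow n"]) (simp add: Vpow_BD_alg)
  qed
  moreover have "cvs.subspace (gns_domain N)"
    unfolding cvs.subspace_def
  proof (intro conjI ballI allI)
    show "0 \<in> gns_domain N" unfolding gns_domain_def using BD_alg_0 by (auto intro!: exI[of _ 0])
    fix x assume "x \<in> gns_domain N"
    then obtain a where a: "a \<in> BD_alg N" "x = a (E 0)" by (auto simp: gns_domain_def gns_class_id)
    { fix y assume "y \<in> gns_domain N"
      then obtain b where "b \<in> BD_alg N" "y = b (E 0)" by (auto simp: gns_domain_def gns_class_id)
      with a show "x + y \<in> gns_domain N"
        by (auto simp: gns_domain_def gns_class_id blinfun.add_left intro!: exI[of _ "a + b"] BD_alg_add) }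
    fix c
    have "scal c o\<^sub>L a \<in> BD_alg N"
      using BD_alg_mult[OF BD_alg_monom[OF scal_Bdiag, of 0 c] a(1)] by (simp add: Vpow_0)
    with a show "cscale c x \<in> gns_domain N"
      by (auto simp: gns_domain_def gns_class_id scal_apply intro!: exI[of _ "scal c o\<^sub>L a"])
  qed
  ultimately show "cvs.span (range E) \<subseteq> gns_domain N" by (intro cvs.span_minimal) auto
qed

lemma gns_rotation_eq: "gns_rotation N \<theta> = diag_op (\<lambda>l. cis (\<theta> * l))"
  unfolding gns_rotation_def
proof (rule the_equality)
  let ?R = "diag_op (\<lambda>l. cis (\<theta> * l))"
  have inv: "?R (diag_op (\<lambda>l. cis (- (\<theta> * l))) x) = x" for x
    by (rule ell2_eqI) (simp add: mult.assoc[symmetric] cis_mult)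
  have "?R (E 0) = E 0" and rE: "diag_op (\<lambda>l. cis (- (\<theta> * l))) (E 0) = E 0"
    by (rule ell2_eqI; simp)+
  have "Vector_Spaces.linear cscale cscale (blinfun_apply ?R)"
    by (unfold_locales) (auto intro!: ell2_eqI simp: blinfun.add_right algebra_simps)
  moreover have "surj (blinfun_apply ?R)" using inv by (metis surjI)
  moreover have "cinner (?R x) (?R y) = cinner x y" for x y
  proof -
    have "cnj (cis t * u) * (cis t * v) = cnj u * v" for t u v
      by (simp add: cis_cnj mult_ac) (simp add: mult.assoc[symmetric] cis_mult)
    then have "cnj (coord (?R x) l) * coord (?R y) l = cnj (coord x l) * coord y l" for l
      unfolding coord_rot .
    then show ?thesis by (simp only: cinner_def)
  qed
  ultimately have R: "is_unitary ?R" by (simp add: is_unitary_def)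
  have Rc: "?R (gns_class b) = gns_class (rho \<theta> b)" if "b \<in> BD_alg N" for b
    using that by (simp add: gns_class_eq[OF that] gns_class_eq[OF rho_BD_alg[OF that]]) (simp add: rho_def rE)
  show "is_unitary ?R \<and> (\<forall>b\<in>BD_alg N. ?R (gns_class b) = gns_class (rho \<theta> b))"
    using R Rc by blast
  fix U assume U: "is_unitary U \<and> (\<forall>b\<in>BD_alg N. U (gns_class b) = gns_class (rho \<theta> b))"
  have UE: "U (E k) = ?R (E k)" for k
  proof -
    have "Vpow k (E 0) = E k" by (rule ell2_eqI) auto
    then have "gns_class (Vpow k) = E k" using gns_class_eq[OF Vpow_BD_alg] by simp
    then show ?thesis using U Rc Vpow_BD_alg by metis
  qed
  show "U = ?R"
  proof (rule blinfun_eqI)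
    fix x
    obtain z where z: "U x = ?R z" using R by (metis is_unitary_def surjD)
    have "coord z k = coord x k" for k
      using z UE U R by (metis cinner_E is_unitary_def)
    then show "U x = ?R x" using z ell2_eqI by metis
  qed
qed

end

theory Submission
  imports Defs
begin

text \<open>
  Covariance forces a derivation, respectively its implementation, to shift degrees by \<open>n\<close>. If some
  \<open>j\<close> dividing \<open>N\<close> does not divide \<open>n\<close>, then \<open>\<eta>\<close> is read off from the value of \<open>\<delta>\<close> on the character
  \<open>l \<mapsto> exp (2\<pi>il/j)\<close>, and is bounded by the norm of that value; otherwise \<open>\<delta>\<close> kills the diagonal
  subalgebra and \<open>\<eta>\<close> is found by summing the coefficients of \<open>\<delta> V\<close>. An implementation sends \<open>E k\<close> to
  \<open>d k\<close> times \<open>E (k + n)\<close>, where \<open>d\<close> implements \<open>\<delta>\<close> itself and hence differs from \<open>\<eta>\<close> by a constant.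
  Its closure is the maximal weighted shift, so the operators \<open>I + D\<^sup>*D\<close> and \<open>I + DD\<^sup>*\<close> are
  multiplications by \<open>1 + \<bar>d l\<bar>\<^sup>2\<close> and its translate. A diagonal operator is compact if and only if its
  entries tend to zero, and the square of a compact inverse square root is still compact, so
  uniqueness of positive square roots is not needed.
\<close>


section \<open>Complex linearity and finitely supported vectors\<close>

lemma clinear_blinfun_iff:
  "clinear (blinfun_apply A) \<longleftrightarrow> (\<forall>c x. A (cscale c x) = cscale c (A x))"
  by (auto simp: Vector_Spaces.linear_iff blinfun.add_right cvs.vector_space_axioms)

text \<open>Each commutation equation is a closed condition on \<open>A\<close>, which yields
  closedness of the set of complex-linear operators.\<close>

lemma clinear_iff_commutes_scal: "clinear (blinfun_apply A) \<longleftrightarrow> (\<forall>c. A o\<^sub>L scal c = scal c o\<^sub>L A)"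
proof
  assume "clinear (blinfun_apply A)"
  then show "\<forall>c. A o\<^sub>L scal c = scal c o\<^sub>L A"
    by (auto simp: clinear_blinfun_iff scal_apply intro: blinfun_eqI)
next
  assume "\<forall>c. A o\<^sub>L scal c = scal c o\<^sub>L A"
  then show "clinear (blinfun_apply A)"
    unfolding clinear_blinfun_iff by (metis blinfun_apply_blinfun_compose scal_apply)
qed

lemma cinner_cscale_right: "cinner x (cscale c y) = c * cinner x y"
proof -
  have "cinner x (cscale c y) = (\<Sum>\<^sub>\<infinity>l. c * (cnj (coord x l) * coord y l))"
    by (simp add: cinner_def mult_ac)
  also have "\<dots> = c * cinner x y"
    unfolding cinner_def by (intro infsum_cmult_right cinner_summable)
  finally show ?thesis .
qed

lemma cinner_cscale_left: "cinner (cscale c x) y = cnj c * cinner x y"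
  by (metis cinner_commute cinner_cscale_right complex_cnj_mult)

text \<open>The coordinate \<open>l\<close> of \<open>B x\<close> is
  \<open>cinner (A (E l)) x\<close>, which is complex linear in \<open>x\<close>.\<close>

lemma adjoint_clinear:
  assumes "is_adjoint A B"
  shows "clinear (blinfun_apply B)"
  unfolding clinear_blinfun_iff
proof (intro allI ell2_eqI)
  fix c x l
  show "coord (B (cscale c x)) l = coord (cscale c (B x)) l"
    using assms unfolding is_adjoint_def by (metis cinner_E cinner_cscale_right)
qed

text \<open>Forces the elements of \<open>BD N\<close>, an intersection of C*-subalgebras, to be
  complex linear, so that values of \<open>\<delta>\<close> are controlled on finitely supported
  vectors by their action on the \<open>E k\<close>.\<close>

lemma clinear_cstar_subalgebra: "cstar_subalgebra {A. clinear (blinfun_apply A)}"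
proof -
  have "{A. clinear (blinfun_apply A)} = (\<Inter>c. {A. A o\<^sub>L scal c = scal c o\<^sub>L A})"
    by (auto simp: clinear_iff_commutes_scal)
  moreover have "closed (\<Inter>c. {A. A o\<^sub>L scal c = scal c o\<^sub>L A})"
    by (intro closed_INT ballI closed_Collect_eq continuous_intros)
  ultimately have "closed {A. clinear (blinfun_apply A)}" by simp
  then show ?thesis
    unfolding cstar_subalgebra_def
    by (auto simp: clinear_blinfun_iff blinfun.add_left cvs.scale_right_distrib scal_apply mult.commute
        intro: adjoint_clinear[unfolded clinear_blinfun_iff, rule_format])
qed

lemma Bdiag_clinear: "B \<in> Bdiag_alg N \<Longrightarrow> clinear (blinfun_apply B)"
  by (auto elim!: Bdiag_algE intro!: ell2_eqI simp: clinear_blinfun_iff)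

lemma BD_clinear: "A \<in> BD N \<Longrightarrow> clinear (blinfun_apply A)"
proof -
  have "insert V (Bdiag_alg N) \<subseteq> {A. clinear (blinfun_apply A)}"
    using Bdiag_clinear by (auto simp: V_def clinear_blinfun_iff intro!: ell2_eqI)
  then show "A \<in> BD N \<Longrightarrow> clinear (blinfun_apply A)"
    unfolding BD_def cstar_generated_def using clinear_cstar_subalgebra by blast
qed

lemma ell2_eq_sum_E:
  assumes "finite S" "{l. coord x l \<noteq> 0} \<subseteq> S"
  shows "x = (\<Sum>l\<in>S. cscale (coord x l) (E l))"
  using assms by (intro ell2_eqI) (auto simp: if_distrib sum.delta cong: if_cong)

lemma span_E_iff: "x \<in> cvs.span (range E) \<longleftrightarrow> finite {l. coord x l \<noteq> 0}"
proof
  have "cvs.subspace {x. finite {l. coord x l \<noteq> 0}}"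
    unfolding cvs.subspace_def
  proof (safe; simp)
    fix x y assume "finite {l. coord x l \<noteq> 0}" "finite {l. coord y l \<noteq> 0}"
    then show "finite {l. coord x l + coord y l \<noteq> 0}"
      by (rule finite_subset[OF _ finite_UnI, rotated]) auto
  qed
  moreover have "range E \<subseteq> {x. finite {l. coord x l \<noteq> 0}}" by auto
  ultimately show "x \<in> cvs.span (range E) \<Longrightarrow> finite {l. coord x l \<noteq> 0}"
    using cvs.span_minimal by blast
next
  assume "finite {l. coord x l \<noteq> 0}"
  then have "x = (\<Sum>l | coord x l \<noteq> 0. cscale (coord x l) (E l))" by (rule ell2_eq_sum_E) simp
  also have "\<dots> \<in> cvs.span (range E)"
    by (intro cvs.span_sum cvs.span_scale cvs.span_base rangeI)
  finally show "x \<in> cvs.span (range E)" .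
qed

lemma E_in_span: "E k \<in> cvs.span (range E)"
  by (simp add: cvs.span_base)

lemma coord_diag_span: "x \<in> cvs.span (range E) \<Longrightarrow> coord (diag b x) l = b l * coord x l"
  by (simp add: span_E_iff coord_diag_fin)

lemma Vpow_span: "x \<in> cvs.span (range E) \<Longrightarrow> Vpow n x \<in> cvs.span (range E)"
proof -
  assume "x \<in> cvs.span (range E)"
  then have "finite ((\<lambda>l. l + n) ` {l. coord x l \<noteq> 0})" by (simp add: span_E_iff)
  moreover have "{l. coord (Vpow n x) l \<noteq> 0} \<subseteq> (\<lambda>l. l + n) ` {l. coord x l \<noteq> 0}"
    by (auto simp: image_iff) (metis diff_add_cancel)
  ultimately show ?thesis unfolding span_E_iff by (rule finite_subset[rotated])
qed

lemma diag_span: "x \<in> cvs.span (range E) \<Longrightarrow> diag b x \<in> cvs.span (range E)"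
  unfolding span_E_iff by (rule finite_subset[rotated]) (auto simp: coord_diag_fin)

lemma BD_alg_span: "b \<in> BD_alg N \<Longrightarrow> x \<in> cvs.span (range E) \<Longrightarrow> b x \<in> cvs.span (range E)"
proof -
  assume b: "b \<in> BD_alg N" and x: "x \<in> cvs.span (range E)"
  have "B x \<in> cvs.span (range E)" if "B \<in> Bdiag_alg N" for B
    using x that unfolding span_E_iff by (elim Bdiag_algE) (erule finite_subset[rotated], auto)
  then show ?thesis
    using b by (auto simp: BD_alg_def blinfun_sum_apply intro!: cvs.span_sum Vpow_span)
qed

lemma clinear_BD_alg: "b \<in> BD_alg N \<Longrightarrow> clinear (blinfun_apply b)"
proof -
  assume "b \<in> BD_alg N"
  then obtain F B where F: "finite F" "\<forall>n\<in>F. B n \<in> Bdiag_alg N" "b = (\<Sum>n\<in>F. Vpow n o\<^sub>L B n)"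
    by (auto simp: BD_alg_def)
  have "coord (B m (cscale c x)) l = c * coord (B m x) l" if "m \<in> F" for m c x l
    using Bdiag_clinear[of "B m" N] F(2) that by (auto simp: clinear_blinfun_iff)
  then show ?thesis
    by (auto simp: clinear_blinfun_iff F(3) blinfun_sum_apply sum_distrib_left intro!: ell2_eqI)
qed

text \<open>Both sides are complex linear in \<open>x\<close> and agree on the basis, so span
  induction applies.\<close>

lemma coord_weighted_shift:
  assumes "clinear (blinfun_apply A)" "x \<in> cvs.span (range E)"
    and "\<And>k. A (E k) = cscale (a k) (E (k + m))"
  shows "coord (A x) l = a (l - m) * coord x (l - m)"
proof -
  have "\<forall>l. coord (A x) l = a (l - m) * coord x (l - m)"
    using assms(2)
  proof (rule cvs.span_induct)
    show "cvs.subspace {x. \<forall>l. coord (A x) l = a (l - m) * coord x (l - m)}"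
      using assms(1) by (auto simp: cvs.subspace_def blinfun.add_right clinear_blinfun_iff algebra_simps)
  qed (auto simp: assms(3))
  then show ?thesis ..
qed


section \<open>Covariant derivations\<close>

text \<open>The weight is indexed by the source \<open>E k\<close>; \<open>d\<close> may be
  unbounded, so the operator is used on finitely supported vectors.\<close>

definition wshift :: "int \<Rightarrow> (int \<Rightarrow> complex) \<Rightarrow> ell2 \<Rightarrow> ell2" where
  "wshift n d x = Vpow n (diag d x)"

lemma coord_wshift: "x \<in> cvs.span (range E) \<Longrightarrow> coord (wshift n d x) l = d (l - n) * coord x (l - n)"
  by (simp add: wshift_def coord_diag_span)

lemma wshift_add:
  "x \<in> cvs.span (range E) \<Longrightarrow> y \<in> cvs.span (range E) \<Longrightarrow> wshift n d (x + y) = wshift n d x + wshift n d y"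
  by (rule ell2_eqI) (simp add: coord_wshift cvs.span_add distrib_left)

lemma wshift_cscale: "x \<in> cvs.span (range E) \<Longrightarrow> wshift n d (cscale c x) = cscale c (wshift n d x)"
  by (rule ell2_eqI) (simp add: coord_wshift cvs.span_scale)

lemma wshift_E: "wshift n d (E k) = cscale (d k) (E (k + n))"
  by (rule ell2_eqI) (auto simp: coord_wshift E_in_span)

lemma implemented_by_wshift:
  "implemented_by N n \<delta> \<eta> \<longleftrightarrow> (\<forall>b\<in>BD_alg N. \<forall>x\<in>cvs.span (range E).
     \<delta> b x = wshift n \<eta> (b x) - b (wshift n \<eta> x))"
  by (simp add: implemented_by_def wshift_def)

lemma V_BD_alg: "V \<in> BD_alg N"
  by (simp add: V_def Vpow_BD_alg)

lemma Bdiag_BD_alg: "B \<in> Bdiag_alg N \<Longrightarrow> B \<in> BD_alg N"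
  using BD_alg_monom[of B N 0] by (simp add: Vpow_0)

lemma derivation_add: "derivation N \<delta> \<Longrightarrow> a \<in> BD_alg N \<Longrightarrow> b \<in> BD_alg N \<Longrightarrow> \<delta> (a + b) = \<delta> a + \<delta> b"
  and derivation_scal: "derivation N \<delta> \<Longrightarrow> a \<in> BD_alg N \<Longrightarrow> \<delta> (scal c o\<^sub>L a) = scal c o\<^sub>L \<delta> a"
  and derivation_compose: "derivation N \<delta> \<Longrightarrow> a \<in> BD_alg N \<Longrightarrow> b \<in> BD_alg N \<Longrightarrow>
      \<delta> (a o\<^sub>L b) = (\<delta> a o\<^sub>L b) + (a o\<^sub>L \<delta> b)"
  and derivation_BD: "derivation N \<delta> \<Longrightarrow> a \<in> BD_alg N \<Longrightarrow> \<delta> a \<in> BD N"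
  by (simp_all add: derivation_def)

lemma derivation_id: assumes "derivation N \<delta>" shows "\<delta> id_blinfun = 0"
  using derivation_compose[OF assms, of id_blinfun id_blinfun] Vpow_BD_alg[of 0 N] by (simp add: Vpow_0)

lemma derivation_0: assumes "derivation N \<delta>" shows "\<delta> 0 = 0"
  using derivation_add[OF assms BD_alg_0 BD_alg_0] by simp

section \<open>Reduction of the commutator identity to generators\<close>

text \<open>A commutator satisfies the Leibniz rule, so agreement of \<open>\<delta>\<close> with it
  passes to sums, products and the inverse of \<open>V\<close>. On generators the hypotheses give
  agreement on basis vectors, and complex linearity extends it to their span.\<close>

lemma implemented_by_generators:
  assumes der: "derivation N \<delta>"
    and V: "\<And>l. \<delta> V (E l) = cscale (\<eta> (l + 1) - \<eta> l) (E (l + (n + 1)))"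
    and B: "\<And>B b l. B \<in> Bdiag_alg N \<Longrightarrow> (\<And>x k. coord (B x) k = b k * coord x k) \<Longrightarrow>
        \<delta> B (E l) = cscale (\<eta> l * (b l - b (l + n))) (E (l + n))"
  shows "implemented_by N n \<delta> \<eta>"
proof -
  let ?S = "cvs.span (range E)" and ?W = "wshift n \<eta>"
  define C where "C b \<longleftrightarrow> b \<in> BD_alg N \<and> (\<forall>x\<in>?S. \<delta> b x = ?W (b x) - b (?W x))" for b
  have C_V: "C V"
  proof -
    have "coord (\<delta> V x) l = coord (?W (V x) - V (?W x)) l" if x: "x \<in> ?S" for x l
    proof -
      have "coord (\<delta> V x) l = (\<eta> (l - (n + 1) + 1) - \<eta> (l - (n + 1))) * coord x (l - (n + 1))"
        by (rule coord_weighted_shift[OF BD_clinear[OF derivation_BD[OF der V_BD_alg]] x V])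
      then show ?thesis using x
        by (simp add: coord_wshift V_def Vpow_span left_diff_distrib algebra_simps)
    qed
    then show ?thesis by (simp add: C_def V_BD_alg ell2_eqI)
  qed
  have C_B: "C B" if mem: "B \<in> Bdiag_alg N" for B
  proof -
    obtain b where b: "\<And>x l. coord (B x) l = b l * coord x l"
      using mem by (elim Bdiag_algE) blast
    have "coord (\<delta> B x) l = coord (?W (B x) - B (?W x)) l" if x: "x \<in> ?S" for x l
    proof -
      have "coord (\<delta> B x) l = \<eta> (l - n) * (b (l - n) - b (l - n + n)) * coord x (l - n)"
        by (rule coord_weighted_shift[OF BD_clinear[OF derivation_BD[OF der Bdiag_BD_alg[OF mem]]] x])
          (rule B[OF mem b])
      then show ?thesis using x
        by (simp add: coord_wshift b BD_alg_span[OF Bdiag_BD_alg[OF mem]] algebra_simps)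
    qed
    then show ?thesis by (simp add: C_def Bdiag_BD_alg[OF mem] ell2_eqI)
  qed
  have C_mult: "C (a o\<^sub>L b)" if "C a" "C b" for a b
    unfolding C_def
  proof (intro conjI ballI)
    show "a o\<^sub>L b \<in> BD_alg N" using that by (simp add: C_def BD_alg_mult)
    fix x assume x: "x \<in> ?S"
    then have "b x \<in> ?S" using that BD_alg_span C_def by blast
    then show "\<delta> (a o\<^sub>L b) x = ?W ((a o\<^sub>L b) x) - (a o\<^sub>L b) (?W x)"
      using that x by (simp add: C_def derivation_compose[OF der] blinfun.add_left blinfun.diff_right)
  qed
  have C_0: "C 0"
    unfolding C_def using cvs.span_zero
    by (auto simp: BD_alg_0 derivation_0[OF der] coord_wshift intro!: ell2_eqI)
  have C_add: "C (a + b)" if "C a" "C b" for a b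
    unfolding C_def
  proof (intro conjI ballI)
    show "a + b \<in> BD_alg N" using that by (simp add: C_def BD_alg_add)
    fix x assume x: "x \<in> ?S"
    then have "a x \<in> ?S" "b x \<in> ?S" using that BD_alg_span C_def by blast+
    then show "\<delta> (a + b) x = ?W ((a + b) x) - (a + b) (?W x)"
      using that x by (simp add: C_def derivation_add[OF der] blinfun.add_left wshift_add)
  qed
  have C_sum: "C (sum f F)" if "\<And>i. i \<in> F \<Longrightarrow> C (f i)" for f and F :: "int set"
    using that by (induction F rule: infinite_finite_induct) (auto intro: C_add C_0)
  have VVinv: "V o\<^sub>L Vpow (- 1) = id_blinfun" and VinvV: "Vpow (- 1) o\<^sub>L V = id_blinfun"
    unfolding V_def Vpow_add[symmetric] by (simp_all add: Vpow_0)
  have C_Vinv: "C (Vpow (- 1))"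
  proof -
    have "\<delta> (Vpow (- 1)) x = ?W (Vpow (- 1) x) - Vpow (- 1) (?W x)" if x: "x \<in> ?S" for x
    proof -
      \<comment> \<open>Differentiating \<open>V o\<^sub>L Vpow (- 1) = id_blinfun\<close>, where
        \<open>\<delta>\<close> kills the identity, expresses the value at the inverse through the
        value at \<open>V\<close>.\<close>
      have "(\<delta> V o\<^sub>L Vpow (- 1)) + (V o\<^sub>L \<delta> (Vpow (- 1))) = 0"
        using derivation_compose[OF der V_BD_alg Vpow_BD_alg, of "- 1"] derivation_id[OF der] VVinv by simp
      then have "V (\<delta> (Vpow (- 1)) x) = - \<delta> V (Vpow (- 1) x)"
        by (metis add_eq_0_iff blinfun.add_left blinfun.zero_left blinfun_apply_blinfun_compose)
      also have "\<dots> = V (?W (Vpow (- 1) x)) - ?W ((V o\<^sub>L Vpow (- 1)) x)"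
        using C_V x by (simp add: C_def Vpow_span)
      finally have "(Vpow (- 1) o\<^sub>L V) (\<delta> (Vpow (- 1)) x) =
          (Vpow (- 1) o\<^sub>L V) (?W (Vpow (- 1) x)) - Vpow (- 1) (?W x)"
        by (simp add: VVinv blinfun.diff_right)
      then show ?thesis by (simp add: VinvV)
    qed
    then show ?thesis by (simp add: C_def Vpow_BD_alg)
  qed
  \<comment> \<open>Two-sided induction from 0: upward steps multiply by \<open>V\<close>, downward
    steps by its inverse.\<close>
  have C_Vpow: "C (Vpow k)" for k
  proof (induction k rule: int_induct[where k = 0])
    case base
    show ?case using C_B[OF scal_Bdiag[of 1]] by (simp add: Vpow_0 scal_1)
  next
    case (step1 i)
    then show ?case using C_mult[OF _ C_V] by (simp add: Vpow_add V_def)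
  next
    case (step2 i)
    then show ?case using C_mult[OF _ C_Vinv] by (metis Vpow_add diff_conv_add_uminus)
  qed
  have "C b" if b: "b \<in> BD_alg N" for b
  proof -
    obtain F B where F: "b = (\<Sum>n\<in>F. Vpow n o\<^sub>L B n)" "finite F" "\<forall>n\<in>F. B n \<in> Bdiag_alg N"
      using b by (auto simp: BD_alg_def)
    show ?thesis unfolding F(1) using F(3) by (intro C_sum C_mult C_Vpow C_B) auto
  qed
  then show ?thesis by (simp add: implemented_by_wshift C_def)
qed

section \<open>Homogeneity from rotation covariance\<close>

text \<open>For this \<open>\<theta>\<close> the phases differ by pi or -pi, so up to a nonzero
  factor the equation says that \<open>a\<close> equals its negative.\<close>

lemma cis_phases_differ:
  assumes "cis s * a = cis t * a" "s - t = real_of_int d * \<theta>" "\<theta> = pi / \<bar>real_of_int d\<bar>" "d \<noteq> 0"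
  shows "a = 0"
proof -
  have "cis (s - t) = - 1"
  proof (cases "d > 0")
    case True
    then show ?thesis using assms by simp
  next
    case False
    then have "s - t = - pi" using assms by simp
    then show ?thesis by (simp add: complex_eq_iff)
  qed
  moreover have "cis s = cis (s - t) * cis t" by (simp add: cis_mult)
  ultimately show ?thesis using assms(1) by simp
qed

text \<open>Covariance equates the coordinate \<open>l\<close> of the image of \<open>E k\<close>
  with itself times the phase of angle \<open>(k + n + m - l) * \<theta>\<close>; a choice of
  \<open>\<theta>\<close> making this phase -1 kills the coordinate unless
  \<open>l = k + n + m\<close>.\<close>

lemma covariant_derivation_homogeneous:
  assumes cov: "covariant_derivation N n \<delta>" and B: "B \<in> Bdiag_alg N"
  shows "\<delta> (Vpow m o\<^sub>L B) (E k) = cscale (coord (\<delta> (Vpow m o\<^sub>L B) (E k)) (k + (n + m))) (E (k + (n + m)))"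
proof -
  let ?b = "Vpow m o\<^sub>L B"
  have der: "derivation N \<delta>" using cov by (simp add: covariant_derivation_def)
  have b: "?b \<in> BD_alg N" by (rule BD_alg_monom[OF B])
  have lin: "clinear (blinfun_apply (\<delta> ?b))" by (rule BD_clinear[OF derivation_BD[OF der b]])
  have "coord (\<delta> ?b (E k)) l = 0" if l: "l \<noteq> k + (n + m)" for l
  proof -
    let ?d = "k + (n + m) - l" and ?a = "coord (\<delta> ?b (E k)) l"
    \<comment> \<open>This angle is at most pi, hence inside the interval where covariance is
      assumed, and makes \<open>?d * \<theta>\<close> equal to pi or -pi.\<close>
    define \<theta> where "\<theta> = pi / \<bar>real_of_int ?d\<bar>"
    have d: "?d \<noteq> 0" using l by simp
    then have d1: "1 \<le> \<bar>real_of_int ?d\<bar>" by linarith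
    have "pi / \<bar>real_of_int ?d\<bar> \<le> pi" using d1 by (simp add: divide_le_eq)
    then have "\<theta> \<in> {0..<2 * pi}"
      unfolding \<theta>_def using pi_gt_zero by (simp add: divide_nonneg_nonneg del: pi_gt_zero) 
    then have "rho (- \<theta>) (\<delta> (rho \<theta> ?b)) = scal (cis (- real_of_int n * \<theta>)) o\<^sub>L \<delta> ?b"
      using cov b unfolding covariant_derivation_def by blast
    then have "rho (- \<theta>) (scal (cis (real_of_int m * \<theta>)) o\<^sub>L \<delta> ?b) = scal (cis (- real_of_int n * \<theta>)) o\<^sub>L \<delta> ?b"
      by (simp only: rho_monom[OF B] derivation_scal[OF der b])
    then have "coord (rho (- \<theta>) (scal (cis (real_of_int m * \<theta>)) o\<^sub>L \<delta> ?b) (E k)) l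
        = cis (- real_of_int n * \<theta>) * ?a" by simp
    moreover have "diag_op (\<lambda>l. cis (\<theta> * real_of_int l)) (E k) = cscale (cis (\<theta> * k)) (E k)"
      by (rule ell2_eqI) simp
    ultimately have "cis (- (\<theta> * l)) * (cis (m * \<theta>) * (cis (\<theta> * k) * ?a)) = cis (- (n * \<theta>)) * ?a"
      using lin by (simp add: rho_def clinear_blinfun_iff)
    then have "cis (- (\<theta> * l) + m * \<theta> + \<theta> * k) * ?a = cis (- (n * \<theta>)) * ?a"
      by (simp only: mult.assoc[symmetric] cis_mult add.assoc)
    then show ?thesis
    proof (rule cis_phases_differ)
      show "- (\<theta> * l) + m * \<theta> + \<theta> * k - - (n * \<theta>) = ?d * \<theta>" by (simp add: algebra_simps)
    qed (use d \<theta>_def in auto)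
  qed
  then show ?thesis by (intro ell2_eqI) auto
qed

lemma Bdiag_E: "(\<And>x l. coord (blinfun_apply B x) l = b l * coord x l) \<Longrightarrow> B (E l) = cscale (b l) (E l)"
  by (rule ell2_eqI) auto

lemma derivation_diag_E:
  assumes "covariant_derivation N n \<delta>" "B \<in> Bdiag_alg N"
  shows "\<delta> B (E l) = cscale (coord (\<delta> B (E l)) (l + n)) (E (l + n))"
  using covariant_derivation_homogeneous[OF assms, of 0 l] by (simp add: Vpow_0)

lemma derivation_V_E:
  assumes "covariant_derivation N n \<delta>"
  shows "\<delta> V (E l) = cscale (coord (\<delta> V (E l)) (l + (n + 1))) (E (l + (n + 1)))"
  using covariant_derivation_homogeneous[OF assms scal_Bdiag, of 1 1 l] by (simp add: V_def scal_1)

text \<open>In the Leibniz rule \<open>C\<close> acts on \<open>E l\<close> before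
  \<open>\<delta> B\<close>, while \<open>B\<close> acts after \<open>\<delta> C\<close> has moved
  \<open>E l\<close> to degree \<open>l + n\<close>; hence the different arguments of
  \<open>c\<close> and \<open>b\<close>.\<close>

lemma derivation_diag_compose:
  assumes cov: "covariant_derivation N n \<delta>"
    and B: "B \<in> Bdiag_alg N" "\<And>x l. coord (B x) l = b l * coord x l"
    and C: "C \<in> Bdiag_alg N" "\<And>x l. coord (C x) l = c l * coord x l"
  shows "coord (\<delta> (B o\<^sub>L C) (E l)) (l + n) =
    c l * coord (\<delta> B (E l)) (l + n) + b (l + n) * coord (\<delta> C (E l)) (l + n)"
proof -
  have der: "derivation N \<delta>" using cov by (simp add: covariant_derivation_def)
  have "clinear (blinfun_apply (\<delta> B))" by (rule BD_clinear[OF derivation_BD[OF der Bdiag_BD_alg[OF B(1)]]])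
  moreover have "\<delta> (B o\<^sub>L C) (E l) = \<delta> B (C (E l)) + B (\<delta> C (E l))"
    by (simp add: derivation_compose[OF der] Bdiag_BD_alg B(1) C(1) blinfun.add_left)
  ultimately show ?thesis
    by (simp add: Bdiag_E[of C c, OF C(2)] B(2) clinear_blinfun_iff)
qed

section \<open>Existence of an implementing weight\<close>

lemma int_shift_invariant:
  assumes "\<And>l::int. f (l + 1) = f l"
  shows "f l = f 0"
proof (induction l rule: int_induct[where k = 0])
  case (step2 i)
  then show ?case using assms[of "i - 1"] by simp
qed (simp_all add: assms)

lemma int_antidifference:
  fixes g :: "int \<Rightarrow> complex"
  obtains f where "\<And>l. f (l + 1) - f l = g l"
proof
  \<comment> \<open>A discrete primitive normalised at 0: for \<open>l \<ge> 0\<close> the second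
    sum is empty, for \<open>l \<le> 0\<close> the first.\<close>
  let ?f = "\<lambda>l. sum g {0..<l} - sum g {l..<0}"
  fix l :: int
  consider "0 \<le> l" | "l < 0" by linarith
  then show "?f (l + 1) - ?f l = g l"
  proof cases
    case 1
    then have "{0..<l + 1} = insert l {0..<l}" by auto
    then show ?thesis using 1 by simp
  next
    case 2
    then have "{l..<0} = insert l {l + 1..<0}" by auto
    then show ?thesis using 2 by simp
  qed
qed

text \<open>The standard generator of the characters of the integers modulo \<open>j\<close>; its
  value at \<open>n\<close> detects whether \<open>j\<close> divides \<open>n\<close>.\<close>

definition root_character :: "nat \<Rightarrow> int \<Rightarrow> complex" where
  "root_character j l = cis (2 * pi * l / j)"

lemma root_character_add: "root_character j (k + l) = root_character j k * root_character j l"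
  by (simp add: root_character_def cis_mult add_divide_distrib distrib_left)

lemma norm_root_character [simp]: "cmod (root_character j l) = 1"
  by (simp add: root_character_def)

lemma root_character_nonzero [simp]: "root_character j l \<noteq> 0"
  by (simp add: root_character_def)

lemma root_character_eq_1_iff:
  assumes "0 < j" shows "root_character j l = 1 \<longleftrightarrow> int j dvd l"
proof
  assume "root_character j l = 1"
  then have "cos (2 * pi * l / j) = 1" by (simp add: root_character_def complex_eq_iff)
  then obtain m :: int where "2 * pi * l / j = m * 2 * pi" by (auto simp: cos_one_2pi_int)
  then have "real_of_int l = real_of_int (m * int j)" using assms by (simp add: field_simps)
  then have "l = m * int j" by (simp only: of_int_eq_iff)
  then show "int j dvd l" by simp
next
  assume "int j dvd l"
  then obtain m where "l = int j * m" ..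
  then have "2 * pi * l / j = 2 * pi * m" using assms by simp
  then have "root_character j l = cis (2 * pi * m)" by (simp only: root_character_def)
  moreover have "cis (2 * pi * m) = 1"
    by (simp only: complex_eq_iff cis.sel cos_int_2pin sin_int_2pin one_complex.sel)
  ultimately show "root_character j l = 1" by simp
qed

lemma coord_root_character: "coord (diag_op (root_character j) x) l = root_character j l * coord x l"
  by (rule coord_diag_op[where K = 1]) simp

lemma root_character_Bdiag:
  assumes "sn_dvd j N" shows "diag_op (root_character j) \<in> Bdiag_alg N"
proof (rule Bdiag_algI[OF assms _ coord_root_character])
  fix l show "root_character j (l + int j) = root_character j l"
    using assms root_character_eq_1_iff[of j "int j"] by (simp add: root_character_add sn_dvd_def)
qed

text \<open>Diagonal elements commute with \<open>?C\<close>. Applying \<open>\<delta>\<close> to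
  this relation expresses \<open>\<delta> B\<close> through \<open>\<delta> ?C\<close> after
  division by \<open>?w\<close>, nonzero because \<open>j\<close> does not divide \<open>n\<close>.
  The commutation of \<open>V\<close> with \<open>?C\<close> up to a scalar treats
  \<open>\<delta> V\<close> likewise.\<close>

lemma implemented_by_exists_non_dividing:
  assumes cov: "covariant_derivation N n \<delta>" and j: "sn_dvd j N" "\<not> int j dvd n"
  shows "\<exists>\<eta>. implemented_by N n \<delta> \<eta>"
proof -
  have der: "derivation N \<delta>" using cov by (simp add: covariant_derivation_def)
  let ?c = "root_character j" and ?C = "diag_op (root_character j)"
  let ?w = "1 - ?c n"
  have w: "?w \<noteq> 0" using j root_character_eq_1_iff[of j n] by (simp add: sn_dvd_def)
  have C: "?C \<in> Bdiag_alg N" by (rule root_character_Bdiag[OF j(1)])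
  note cC = coord_root_character[of j]
  define \<beta> where "\<beta> B l = coord (\<delta> B (E l)) (l + n)" for B l
  define \<gamma> where "\<gamma> l = coord (\<delta> V (E l)) (l + (n + 1))" for l
  \<comment> \<open>Forced: the commutator with \<open>?C\<close> must have weight
    \<open>\<eta> l * (?c l - ?c (l + n))\<close>, that is
    \<open>\<eta> l * ?c l * ?w\<close>.\<close>
  define \<eta> where "\<eta> l = \<beta> ?C l / (?c l * ?w)" for l
  have \<beta>C: "\<beta> ?C l = \<eta> l * ?c l * ?w" for l using w by (simp add: \<eta>_def)
  have \<beta>: "\<beta> B l = \<eta> l * (b l - b (l + n))"
    if B: "B \<in> Bdiag_alg N" "\<And>x k. coord (B x) k = b k * coord x k" for B b l
  proof -
    have "B o\<^sub>L ?C = ?C o\<^sub>L B" by (intro blinfun_eqI ell2_eqI) (simp add: B(2) cC)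
    then have "\<beta> (B o\<^sub>L ?C) l = \<beta> (?C o\<^sub>L B) l" by simp
    then have "?c l * \<beta> B l + b (l + n) * \<beta> ?C l = b l * \<beta> ?C l + ?c (l + n) * \<beta> B l"
      using derivation_diag_compose[OF cov B C cC] derivation_diag_compose[OF cov C cC B] by (simp add: \<beta>_def)
    then have "?c l * ?w * (\<beta> B l) = ?c l * ?w * (\<eta> l * (b l - b (l + n)))"
      unfolding \<beta>C root_character_add by algebra
    then show ?thesis using w by simp
  qed
  have \<gamma>: "\<gamma> l = \<eta> (l + 1) - \<eta> l" for l
  proof -
    \<comment> \<open>Moving \<open>V\<close> past \<open>?C\<close> translates the character by
      one, which costs the scalar \<open>?c (- 1)\<close>.\<close>
    have "V o\<^sub>L ?C = scal (?c (- 1)) o\<^sub>L (?C o\<^sub>L V)"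
      using root_character_add[of j "- 1"]
      by (intro blinfun_eqI ell2_eqI) (simp add: cC V_def)
    then have "\<delta> (V o\<^sub>L ?C) (E l) = \<delta> (scal (?c (- 1)) o\<^sub>L (?C o\<^sub>L V)) (E l)" by simp
    then have "\<delta> V (?C (E l)) + V (\<delta> ?C (E l)) = cscale (?c (- 1)) (\<delta> ?C (V (E l)) + ?C (\<delta> V (E l)))"
      by (simp add: derivation_compose[OF der] derivation_scal[OF der] V_BD_alg Bdiag_BD_alg[OF C]
          BD_alg_mult blinfun.add_left scal_apply)
    then have "coord (\<delta> V (?C (E l)) + V (\<delta> ?C (E l))) (l + (n + 1)) =
        coord (cscale (?c (- 1)) (\<delta> ?C (V (E l)) + ?C (\<delta> V (E l)))) (l + (n + 1))" by simp
    moreover have "clinear (blinfun_apply (\<delta> V))" by (rule BD_clinear[OF derivation_BD[OF der V_BD_alg]])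
    ultimately have "?c l * \<gamma> l + \<beta> ?C l = ?c (- 1) * (\<beta> ?C (l + 1) + ?c (l + (n + 1)) * \<gamma> l)"
      unfolding \<beta>_def \<gamma>_def
      by (simp add: Bdiag_E[of ?C ?c, OF cC] V_E cC clinear_blinfun_iff) (simp add: V_def add_ac)
    also have "\<dots> = ?c l * (\<eta> (l + 1) * ?w + ?c n * \<gamma> l) * (?c (- 1) * ?c 1)"
      unfolding \<beta>C root_character_add by algebra
    also have "?c (- 1) * ?c 1 = 1" by (simp flip: root_character_add) (simp add: root_character_def)
    finally have "?c l * ?w * \<gamma> l = ?c l * ?w * (\<eta> (l + 1) - \<eta> l)" unfolding \<beta>C by algebra
    then show ?thesis using w by simp
  qed
  have "implemented_by N n \<delta> \<eta>"
  proof (rule implemented_by_generators[OF der])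
    show "\<delta> V (E l) = cscale (\<eta> (l + 1) - \<eta> l) (E (l + (n + 1)))" for l
      using derivation_V_E[OF cov, of l] \<gamma>[of l] by (simp add: \<gamma>_def)
    show "\<delta> B (E l) = cscale (\<eta> l * (b l - b (l + n))) (E (l + n))"
      if "B \<in> Bdiag_alg N" "\<And>x k. coord (B x) k = b k * coord x k" for B b l
      using derivation_diag_E[OF cov that(1), of l] \<beta>[OF that, of l] by (simp add: \<beta>_def)
  qed
  then show ?thesis by blast
qed

text \<open>
  Here \<open>b (l + n) = b l\<close> for every \<open>b\<close>. A function vanishing at \<open>l\<close> is a product of two functions vanishing
  at \<open>l\<close>, so the Leibniz rule forces \<open>\<delta>\<close> to annihilate the diagonal subalgebra.
\<close>

lemma implemented_by_exists_dividing:
  assumes cov: "covariant_derivation N n \<delta>" and dvd: "\<And>j. sn_dvd j N \<Longrightarrow> int j dvd n"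
  shows "\<exists>\<eta>. implemented_by N n \<delta> \<eta>"
proof -
  have der: "derivation N \<delta>" using cov by (simp add: covariant_derivation_def)
  \<comment> \<open>The commutator with \<open>V\<close> has weight
    \<open>\<eta> (l + 1) - \<eta> l\<close>, so the coefficients of \<open>\<delta> V\<close> fix
    \<open>\<eta>\<close> up to a constant.\<close>
  obtain \<eta> where \<eta>: "\<And>l. \<eta> (l + 1) - \<eta> l = coord (\<delta> V (E l)) (l + (n + 1))"
    using int_antidifference[of "\<lambda>l. coord (\<delta> V (E l)) (l + (n + 1))"] by blast
  have *: "b (l + n) = b l \<and> \<delta> B (E l) = 0"
    if B: "B \<in> Bdiag_alg N" and b: "\<And>x k. coord (B x) k = b k * coord x k" for B b l
  proof -
    obtain b' j where j: "sn_dvd j N" and b': "\<And>l. b' (l + int j) = b' l"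
        "\<And>x l. coord (B x) l = b' l * coord x l" by (rule Bdiag_algE[OF B]) blast
    have bb: "b = b'" using b[of "E k" k for k] b'(2)[of "E k" k for k] by auto
    have j0: "0 < j" using j by (simp add: sn_dvd_def)
    have per: "f (m + int j * k) = f m" if "\<And>l. f (l + int j) = f l" for f :: "int \<Rightarrow> complex" and m k
    proof (induction k rule: int_induct[where k = 0])
      case (step1 i)
      then show ?case using that[of "m + int j * i"] by (simp add: algebra_simps)
    next
      case (step2 i)
      then show ?case using that[of "m + int j * (i - 1)"] by (simp add: algebra_simps)
    qed simp
    obtain k where k: "n = int j * k" using dvd[OF j] ..
    have bn: "b (l + n) = b l" unfolding k bb by (rule per) (rule b'(1))
    \<comment> \<open>\<open>p\<close> is 0 on the residue class of \<open>l\<close> modulo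
      \<open>j\<close> and 1 elsewhere. The weight \<open>b m - b l\<close> of \<open>C\<close>
      below also vanishes on that class, so composing \<open>C\<close> with \<open>diag_op p\<close>
      leaves it unchanged.\<close>
    define p :: "int \<Rightarrow> complex" where "p m = (if int j dvd m - l then 0 else 1)" for m
    have pj: "p (m + int j) = p m" for m
    proof -
      have "int j dvd m + int j - l \<longleftrightarrow> int j dvd (m - l) + int j" by (simp add: algebra_simps)
      then show ?thesis by (simp add: p_def)
    qed
    have cP: "coord (diag_op p x) m = p m * coord x m" for x m
      by (rule coord_diag_op[where K = 1]) (simp add: p_def)
    have P: "diag_op p \<in> Bdiag_alg N" by (rule Bdiag_algI[OF j pj cP])
    define C where "C = B + scal (- b l)"
    have C: "C \<in> Bdiag_alg N" unfolding C_def by (intro Bdiag_add B scal_Bdiag)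
    have cC: "coord (C x) m = (b m - b l) * coord x m" for x m
      by (simp add: C_def blinfun.add_left b left_diff_distrib)
    have bl: "b m = b l" if "int j dvd m - l" for m
    proof -
      obtain i where "m - l = int j * i" using \<open>int j dvd m - l\<close> ..
      then have "m = l + int j * i" by simp
      then show ?thesis unfolding bb using per[of b' l i] b'(1) by simp
    qed
    have bp: "(b m - b l) * z = (b m - b l) * (p m * z)" for m z
      using bl[of m] by (cases "int j dvd m - l") (simp_all add: p_def)
    have "C = C o\<^sub>L diag_op p"
      by (intro blinfun_eqI ell2_eqI, unfold blinfun_apply_blinfun_compose cC cP, rule bp)
    \<comment> \<open>Of the two Leibniz terms, one has the factor \<open>p l = 0\<close> and the
      other the factor \<open>b (l + n) - b l = 0\<close>.\<close>
    then have "coord (\<delta> C (E l)) (l + n) = 0"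
      using derivation_diag_compose[OF cov C cC P cP, of l] by (simp add: bn p_def)
    then have "\<delta> C (E l) = 0" using derivation_diag_E[OF cov C, of l] by simp
    moreover have "\<delta> (scal c) = 0" for c
      using derivation_scal[OF der, of id_blinfun c] Vpow_BD_alg[of 0 N] derivation_id[OF der]
      by (simp add: Vpow_0)
    ultimately have "\<delta> B (E l) = 0"
      using derivation_add[OF der Bdiag_BD_alg[OF B] Bdiag_BD_alg[OF scal_Bdiag], of "- b l"] by (simp add: C_def)
    with bn show ?thesis by simp
  qed
  have "implemented_by N n \<delta> \<eta>"
  proof (rule implemented_by_generators[OF der])
    show "\<delta> V (E l) = cscale (\<eta> (l + 1) - \<eta> l) (E (l + (n + 1)))" for l
      unfolding \<eta> by (rule derivation_V_E[OF cov])
    show "\<delta> B (E l) = cscale (\<eta> l * (b l - b (l + n))) (E (l + n))"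
      if "B \<in> Bdiag_alg N" "\<And>x k. coord (B x) k = b k * coord x k" for B b l
      using *[OF that, of l] by (simp add: ell2_eqI)
  qed
  then show ?thesis by blast
qed

section \<open>Uniqueness and boundedness of the weight\<close>

text \<open>The action of \<open>\<delta> V\<close> on \<open>E l\<close> determines
  \<open>\<eta> (l + 1) - \<eta> l\<close>, so the difference of two weights is translation
  invariant.\<close>

lemma implemented_by_unique:
  assumes "implemented_by N n \<delta> \<eta>" "implemented_by N n \<delta> \<eta>'"
  shows "\<exists>c. \<forall>l. \<eta>' l = \<eta> l + c"
proof -
  have *: "coord (\<delta> V (E l)) (l + 1 + n) = \<zeta> (l + 1) - \<zeta> l"
    if "implemented_by N n \<delta> \<zeta>" for \<zeta> l
    using that V_BD_alg E_in_span
    by (simp add: implemented_by_wshift V_E wshift_E) (simp add: V_def)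
  then have "\<eta>' (l + 1) - \<eta> (l + 1) = \<eta>' l - \<eta> l" for l
  proof -
    have "\<eta> (l + 1) - \<eta> l = \<eta>' (l + 1) - \<eta>' l" using *[OF assms(1)] *[OF assms(2)] by simp
    then show ?thesis by algebra
  qed
  then have "\<eta>' l - \<eta> l = \<eta>' 0 - \<eta> 0" for l by (rule int_shift_invariant[of "\<lambda>l. \<eta>' l - \<eta> l"])
  then have "\<eta>' l = \<eta> l + (\<eta>' 0 - \<eta> 0)" for l by (simp add: algebra_simps)
  then show ?thesis by blast
qed

text \<open>On \<open>E l\<close> the commutator with the character operator has size
  \<open>cmod (\<eta> l) * cmod (1 - ?c n)\<close>, which the norm of \<open>\<delta> ?C\<close>
  bounds; the second factor is nonzero and independent of \<open>l\<close>.\<close>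

lemma implemented_by_bounded:
  assumes impl: "implemented_by N n \<delta> \<eta>" and j: "sn_dvd j N" "\<not> int j dvd n"
  obtains K where "\<And>l. cmod (\<eta> l) \<le> K"
proof
  let ?c = "root_character j" and ?C = "diag_op (root_character j)"
  fix l
  have w: "1 - ?c n \<noteq> 0" using j root_character_eq_1_iff[of j n] by (simp add: sn_dvd_def)
  have "\<delta> ?C (E l) = wshift n \<eta> (?C (E l)) - ?C (wshift n \<eta> (E l))"
    using impl Bdiag_BD_alg[OF root_character_Bdiag[OF j(1)]] E_in_span by (simp add: implemented_by_wshift)
  also have "wshift n \<eta> (?C (E l)) = cscale (\<eta> l * ?c l) (E (l + n))"
    by (simp add: Bdiag_E[of ?C ?c, OF coord_root_character] wshift_cscale E_in_span wshift_E mult.commute)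
  also have "?C (wshift n \<eta> (E l)) = cscale (\<eta> l * ?c (l + n)) (E (l + n))"
    by (rule ell2_eqI) (auto simp: wshift_E coord_root_character)
  finally have "coord (\<delta> ?C (E l)) (l + n) = \<eta> l * (?c l * (1 - ?c n))"
    by (simp add: root_character_add right_diff_distrib)
  then have "cmod (\<eta> l) * cmod (1 - ?c n) = cmod (coord (\<delta> ?C (E l)) (l + n))"
    by (simp add: norm_mult)
  also have "\<dots> \<le> norm (\<delta> ?C (E l))" by (rule cmod_coord_le)
  also have "\<dots> \<le> norm (\<delta> ?C) * norm (E l)" by (rule norm_blinfun)
  also have "norm (E l) = 1"
    by (simp add: norm_eq_sqrt_inner inner_ell2_def)
  finally show "cmod (\<eta> l) \<le> norm (\<delta> ?C) / cmod (1 - ?c n)" using w by (simp add: pos_le_divide_eq)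
qed

section \<open>Implementations in the GNS space\<close>

lemma gns_rotation_inv: "inv (blinfun_apply (gns_rotation N \<theta>)) x = gns_rotation N (- \<theta>) x"
proof -
  have *: "gns_rotation N t (gns_rotation N (- t) y) = y" for t y
    unfolding gns_rotation_eq by (rule ell2_eqI) (simp add: mult.assoc[symmetric] cis_mult)
  have "inj (blinfun_apply (gns_rotation N \<theta>))"
    using *[of "- \<theta>"] by (intro inj_on_inverseI) simp
  then show ?thesis using * by (metis inv_f_f)
qed

lemma gns_rotation_E: "gns_rotation N \<theta> (E k) = cscale (cis (\<theta> * k)) (E k)"
  unfolding gns_rotation_eq by (rule ell2_eqI) simp

text \<open>The phase argument used for derivations, applied to \<open>D\<close>, makes
  \<open>D (E k)\<close> a multiple of \<open>E (k + n)\<close>. Linearity extends this to the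
  domain, and the commutation relation then says that these weights implement
  \<open>\<delta>\<close>.\<close>

lemma covariant_implementation_form:
  assumes "covariant_implementation N n \<delta> D"
  obtains d where "\<And>x. x \<in> gns_domain N \<Longrightarrow> D x = wshift n d x" "implemented_by N n \<delta> d"
proof -
  let ?S = "cvs.span (range E)"
  have add: "\<And>x y. x \<in> ?S \<Longrightarrow> y \<in> ?S \<Longrightarrow> D (x + y) = D x + D y"
    and scale: "\<And>c x. x \<in> ?S \<Longrightarrow> D (cscale c x) = cscale c (D x)"
    and comm: "\<And>b x. b \<in> BD_alg N \<Longrightarrow> x \<in> ?S \<Longrightarrow> D (b x) - b (D x) = \<delta> b x"
    and rot: "\<And>\<theta> x. x \<in> ?S \<Longrightarrow>
        gns_rotation N \<theta> (D (gns_rotation N (- \<theta>) x)) = cscale (cis (real_of_int n * \<theta>)) (D x)"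
    using assms unfolding covariant_implementation_def gns_domain_eq gns_rotation_inv by blast+
  define d where "d k = coord (D (E k)) (k + n)" for k
  have DE: "D (E k) = cscale (d k) (E (k + n))" for k
  proof -
    have "coord (D (E k)) l = 0" if l: "l \<noteq> k + n" for l
    proof -
      let ?m = "l - k - n" and ?a = "coord (D (E k)) l"
      define \<theta> where "\<theta> = pi / \<bar>real_of_int ?m\<bar>"
      have "gns_rotation N \<theta> (cscale (cis (- (\<theta> * real_of_int k))) (D (E k))) = cscale (cis (real_of_int n * \<theta>)) (D (E k))"
        using rot[OF E_in_span, of \<theta> k] by (simp add: gns_rotation_E scale E_in_span)
      then have "coord (gns_rotation N \<theta> (cscale (cis (- (\<theta> * real_of_int k))) (D (E k)))) l =
          coord (cscale (cis (real_of_int n * \<theta>)) (D (E k))) l" by simp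
      then have "cis (\<theta> * real_of_int l) * (cis (- (\<theta> * real_of_int k)) * ?a) = cis (real_of_int n * \<theta>) * ?a"
        by (simp add: gns_rotation_eq)
      then have "cis (\<theta> * real_of_int l - \<theta> * real_of_int k) * ?a = cis (real_of_int n * \<theta>) * ?a"
        by (simp add: mult.assoc[symmetric] cis_mult)
      then show ?thesis
      proof (rule cis_phases_differ)
        show "\<theta> * real_of_int l - \<theta> * real_of_int k - real_of_int n * \<theta> = real_of_int ?m * \<theta>"
          by (simp add: algebra_simps)
      qed (use l \<theta>_def in auto)
    qed
    then show ?thesis by (intro ell2_eqI) (auto simp: d_def)
  qed
  have D: "D x = wshift n d x" if "x \<in> ?S" for x
  proof -
    \<comment> \<open>Membership in \<open>?S\<close> is part of the set because linearity of
      \<open>D\<close> is known only there; scaling the zero vector by 0 gives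
      \<open>D 0 = 0\<close>.\<close>
    have "cvs.subspace {x \<in> ?S. D x = wshift n d x}"
      using scale[OF cvs.span_zero, of 0] cvs.span_zero
      by (auto simp: cvs.subspace_def cvs.span_add cvs.span_scale add scale wshift_add wshift_cscale
          coord_wshift intro!: ell2_eqI)
    moreover have "range E \<subseteq> {x \<in> ?S. D x = wshift n d x}"
      by (auto simp: E_in_span DE wshift_E)
    ultimately show ?thesis using cvs.span_minimal that by blast
  qed
  moreover have "implemented_by N n \<delta> d"
    unfolding implemented_by_wshift using comm by (simp add: D BD_alg_span)
  ultimately show ?thesis using that unfolding gns_domain_eq by blast
qed

text \<open>Multiples of the identity commute with every complex-linear \<open>b\<close>, and
  diagonal operators commute with the diagonal rotations.\<close>

lemma implemented_by_covariant_implementation: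
  assumes "implemented_by N 0 \<delta> \<eta>"
  shows "covariant_implementation N 0 \<delta> (\<lambda>x. diag \<eta> x + cscale c x)"
proof -
  let ?D = "\<lambda>x. diag \<eta> x + cscale c x"
  let ?S = "cvs.span (range E)"
  have rot: "gns_rotation N \<theta> x \<in> ?S" if "x \<in> ?S" for \<theta> x
    using that unfolding gns_rotation_eq span_E_iff by simp
  have coord_D: "coord (?D x) l = (\<eta> l + c) * coord x l" if "x \<in> ?S" for x l
    using that by (simp add: coord_diag_span distrib_right)
  have "?D (x + y) = ?D x + ?D y" if "x \<in> ?S" "y \<in> ?S" for x y
    using that by (intro ell2_eqI) (simp add: coord_diag_span cvs.span_add algebra_simps)
  moreover have "?D (cscale a x) = cscale a (?D x)" if "x \<in> ?S" for a x
    using that by (intro ell2_eqI) (simp add: coord_diag_span cvs.span_scale algebra_simps)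
  moreover have "?D (b x) - b (?D x) = \<delta> b x" if "b \<in> BD_alg N" "x \<in> ?S" for b x
    using that assms clinear_BD_alg[OF that(1)]
    by (simp add: implemented_by_def Vpow_0 blinfun.add_right clinear_blinfun_iff)
  moreover have "gns_rotation N \<theta> (?D (gns_rotation N (- \<theta>) x)) = cscale (cis (0 * \<theta>)) (?D x)"
    if x: "x \<in> ?S" for \<theta> x
  proof (rule ell2_eqI)
    fix l
    have "coord (gns_rotation N \<theta> (?D (gns_rotation N (- \<theta>) x))) l =
      cis (\<theta> * real_of_int l) * ((\<eta> l + c) * (cis (- (\<theta> * real_of_int l)) * coord x l))"
      using coord_D[OF rot[OF x, of "- \<theta>"], of l] by (simp add: gns_rotation_eq del: coord_add)
    also have "\<dots> = (cis (\<theta> * real_of_int l) * cis (- (\<theta> * real_of_int l))) * ((\<eta> l + c) * coord x l)" by (simp only: mult_ac)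
    also have "\<dots> = coord (cscale (cis (0 * \<theta>)) (?D x)) l"
      using coord_D[OF x, of l] by (simp add: cis_mult)
    finally show "coord (gns_rotation N \<theta> (?D (gns_rotation N (- \<theta>) x))) l =
      coord (cscale (cis (0 * \<theta>)) (?D x)) l" .
  qed
  ultimately show ?thesis
    unfolding covariant_implementation_def gns_domain_eq gns_rotation_inv by simp
qed


section \<open>Compact diagonal operators\<close>

lemma norm_ell2_le_coordwise:
  assumes "\<And>l. cmod (coord y l) \<le> K * cmod (coord x l)" "0 \<le> K"
  shows "norm y \<le> K * norm x"
proof -
  have "(norm y)\<^sup>2 \<le> (\<Sum>\<^sub>\<infinity>l. K\<^sup>2 * (cmod (coord x l))\<^sup>2)"
    unfolding norm_ell2_sq
  proof (rule infsum_mono[OF coord_summable])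
    show "(\<lambda>l. K\<^sup>2 * (cmod (coord x l))\<^sup>2) summable_on UNIV"
      by (intro summable_on_cmult_right coord_summable)
    fix l show "(cmod (coord y l))\<^sup>2 \<le> K\<^sup>2 * (cmod (coord x l))\<^sup>2"
      using power_mono[OF assms(1)[of l], of 2] by (simp add: power_mult_distrib)
  qed
  also have "\<dots> = K\<^sup>2 * (norm x)\<^sup>2"
    unfolding norm_ell2_sq by (intro infsum_cmult_right coord_summable)
  finally have "(norm y)\<^sup>2 \<le> (K * norm x)\<^sup>2" by (simp add: power_mult_distrib)
  then show ?thesis by (rule power2_le_imp_le) (simp add: assms(2))
qed

lemma bounded_linear_coord: "bounded_linear (\<lambda>x. coord x l)"
  by (rule bounded_linear_intro[where K = 1]) (auto simp: cmod_coord_le)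

lemma bounded_linear_cscale_left: "bounded_linear (\<lambda>c. cscale c x)"
proof (rule bounded_linear_intro[where K = "norm x"])
  show "norm (cscale c x) \<le> cmod c * norm x" for c
    by (rule norm_ell2_le_coordwise) (simp_all add: norm_mult)
qed (auto intro!: ell2_eqI simp: distrib_right)

text \<open>Reduces compactness of the closure of an image to total boundedness. The limit of a
  Cauchy sequence is taken coordinatewise.\<close>

lemma complete_ell2: "complete (UNIV :: ell2 set)"
  unfolding complete_def
proof (intro allI impI)
  fix X :: "nat \<Rightarrow> ell2"
  assume "(\<forall>k. X k \<in> UNIV) \<and> Cauchy X"
  then have X: "Cauchy X" ..
  have "convergent (\<lambda>k. coord (X k) l)" for l
    using bounded_linear.Cauchy[OF bounded_linear_coord X] by (simp add: Cauchy_convergent_iff)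
  then obtain g where g: "\<And>l. (\<lambda>k. coord (X k) l) \<longlonglongrightarrow> g l"
    unfolding convergent_def by metis
  \<comment> \<open>With \<open>k\<close> and \<open>F\<close> fixed, let \<open>m\<close> tend to
    infinity in the Cauchy estimate; the resulting bound is uniform in \<open>F\<close>.\<close>
  have key: "\<exists>M. \<forall>k\<ge>M. \<forall>F. finite F \<longrightarrow> (\<Sum>l\<in>F. (cmod (coord (X k) l - g l))\<^sup>2) \<le> e\<^sup>2" if "0 < e" for e
  proof -
    obtain M where M: "\<And>k m. k \<ge> M \<Longrightarrow> m \<ge> M \<Longrightarrow> norm (X k - X m) < e"
      using X \<open>0 < e\<close> unfolding Cauchy_def dist_norm by meson
    have "(\<Sum>l\<in>F. (cmod (coord (X k) l - g l))\<^sup>2) \<le> e\<^sup>2" if k: "k \<ge> M" and F: "finite F" for k F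
    proof (rule LIMSEQ_le_const2)
      show "(\<lambda>m. \<Sum>l\<in>F. (cmod (coord (X k) l - coord (X m) l))\<^sup>2) \<longlonglongrightarrow> (\<Sum>l\<in>F. (cmod (coord (X k) l - g l))\<^sup>2)"
        by (intro tendsto_intros g)
      have "(\<Sum>l\<in>F. (cmod (coord (X k) l - coord (X m) l))\<^sup>2) \<le> e\<^sup>2" if "m \<ge> M" for m
      proof -
        have "(\<Sum>l\<in>F. (cmod (coord (X k - X m) l))\<^sup>2) \<le> (norm (X k - X m))\<^sup>2"
          unfolding norm_ell2_sq by (rule finite_sum_le_infsum[OF coord_summable F]) auto
        also have "\<dots> \<le> e\<^sup>2" using M[OF k \<open>m \<ge> M\<close>] by (intro power_mono) auto
        finally show ?thesis by simp
      qed
      then show "\<exists>M. \<forall>m\<ge>M. (\<Sum>l\<in>F. (cmod (coord (X k) l - coord (X m) l))\<^sup>2) \<le> e\<^sup>2" by blast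
    qed
    then show ?thesis by blast
  qed
  \<comment> \<open>\<open>g\<close> differs from one vector \<open>X M\<close> by a sequence whose
    partial sums of squares are bounded.\<close>
  have "(\<lambda>l. (cmod (g l))\<^sup>2) summable_on UNIV"
  proof -
    obtain M where M: "\<And>F. finite F \<Longrightarrow> (\<Sum>l\<in>F. (cmod (coord (X M) l - g l))\<^sup>2) \<le> 1\<^sup>2"
      using key[of 1] by fastforce
    have "(\<lambda>l. (cmod (coord (X M) l - g l))\<^sup>2) summable_on UNIV"
      using M by (intro nonneg_bdd_above_summable_on bdd_aboveI) auto
    then have "(\<lambda>l. (cmod (g l - coord (X M) l))\<^sup>2) summable_on UNIV"
      by (simp only: norm_minus_commute)
    from sqs_add[OF this coord_summable[of "X M"]] show ?thesis by simp
  qed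
  then have x: "coord (Abs_ell2 g) l = g l" for l by (simp add: Abs_ell2_inverse)
  have "X \<longlonglongrightarrow> Abs_ell2 g"
  proof (rule metric_LIMSEQ_I)
    fix e :: real assume e: "0 < e"
    then obtain M where M: "\<And>k F. k \<ge> M \<Longrightarrow> finite F \<Longrightarrow> (\<Sum>l\<in>F. (cmod (coord (X k) l - g l))\<^sup>2) \<le> (e / 2)\<^sup>2"
      using key[of "e / 2"] by auto
    have "dist (X k) (Abs_ell2 g) < e" if k: "k \<ge> M" for k
    proof -
      have "(norm (X k - Abs_ell2 g))\<^sup>2 \<le> (e / 2)\<^sup>2"
        unfolding norm_ell2_sq
        by (rule infsum_le_finite_sums[OF coord_summable]) (use M[OF k] x in auto)
      then have "norm (X k - Abs_ell2 g) \<le> e / 2" by (rule power2_le_imp_le) (use e in simp)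
      then show ?thesis using e by (simp add: dist_norm)
    qed
    then show "\<exists>M. \<forall>k\<ge>M. dist (X k) (Abs_ell2 g) < e" by blast
  qed
  then show "\<exists>x\<in>UNIV. X \<longlonglongrightarrow> x" by blast
qed

text \<open>A new index adds a compact disc in the direction \<open>E k\<close>, and sums of compact
  sets are compact.\<close>

lemma compact_coord_box:
  assumes "finite F"
  shows "compact {x. (\<forall>l\<in>F. cmod (coord x l) \<le> C) \<and> (\<forall>l. l \<notin> F \<longrightarrow> coord x l = 0)}"
  using assms
proof (induction F)
  case empty
  have "{x. \<forall>l. coord x l = 0} = {0}" by (auto intro: ell2_eqI)
  then show ?case by simp
next
  case (insert k F)
  let ?box = "\<lambda>F. {x. (\<forall>l\<in>F. cmod (coord x l) \<le> C) \<and> (\<forall>l. l \<notin> F \<longrightarrow> coord x l = 0)}"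
  let ?L = "(\<lambda>c. cscale c (E k)) ` cball 0 C"
  have "compact ?L"
    by (intro compact_continuous_image compact_cball bounded_linear.continuous_on[OF bounded_linear_cscale_left]
        continuous_on_id)
  then have "compact {u + v | u v. u \<in> ?L \<and> v \<in> ?box F}" using insert.IH by (rule compact_sums)
  also have "{u + v | u v. u \<in> ?L \<and> v \<in> ?box F} = ?box (insert k F)"
  proof (intro subset_antisym subsetI)
    fix x assume x: "x \<in> ?box (insert k F)"
    let ?u = "cscale (coord x k) (E k)"
    have "?u \<in> ?L" using x by (intro imageI) simp
    moreover have "x - ?u \<in> ?box F" using x insert.hyps(2) by auto
    moreover have "x = ?u + (x - ?u)" by simp
    ultimately show "x \<in> {u + v | u v. u \<in> ?L \<and> v \<in> ?box F}" by blast
  qed (use insert.hyps(2) in auto)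
  finally show ?case .
qed

text \<open>Restricting the image of the unit ball to the finitely many coordinates with large
  \<open>r l\<close> lands in a compact box, and the discarded part is uniformly small.\<close>

lemma compact_op_diag:
  assumes r: "\<And>e. 0 < e \<Longrightarrow> finite {l. e \<le> cmod (r l)}" and K: "\<And>l. cmod (r l) \<le> K"
  shows "compact_op (diag_op r)"
proof -
  let ?R = "diag_op r" and ?S = "blinfun_apply (diag_op r) ` cball 0 1"
  note cR = coord_diag_op[of r K, OF K]
  have "complete (closure ?S)" by (rule complete_closed_subset[OF _ _ complete_ell2]) auto
  moreover have "\<exists>k. finite k \<and> closure ?S \<subseteq> (\<Union>x\<in>k. ball x e)" if e: "0 < e" for e
  proof -
    let ?F = "{l. e / 4 \<le> cmod (r l)}"
    have F: "finite ?F" using e by (intro r) simp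
    let ?B = "{x. (\<forall>l\<in>?F. cmod (coord x l) \<le> K) \<and> (\<forall>l. l \<notin> ?F \<longrightarrow> coord x l = 0)}"
    obtain k where k: "finite k" "?B \<subseteq> (\<Union>x\<in>k. ball x (e / 4))"
      using compact_coord_box[OF F, of K] e unfolding compact_eq_totally_bounded
      by (meson divide_pos_pos zero_less_numeral)
    \<comment> \<open>The net and the truncation each contribute \<open>e / 4\<close>. Closed balls
      of radius \<open>e / 2\<close> also cover the closure and lie in open balls of radius
      \<open>e\<close>.\<close>
    have "?S \<subseteq> (\<Union>x\<in>k. cball x (e / 2))"
    proof
      fix y assume "y \<in> ?S"
      then obtain x where x: "norm x \<le> 1" "y = ?R x" by auto
      define u where "u = (\<Sum>l\<in>?F. cscale (r l * coord x l) (E l))"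
      have cu: "coord u l = (if l \<in> ?F then r l * coord x l else 0)" for l
        using F by (simp add: u_def if_distrib[of "(*) _"] sum.delta cong: if_cong)
      have "cmod (r l * coord x l) \<le> K" for l
      proof -
        have "0 \<le> K" using K[of l] norm_ge_zero[of "r l"] by linarith
        then have "cmod (r l) * cmod (coord x l) \<le> K * 1"
          using K order_trans[OF cmod_coord_le x(1)] by (intro mult_mono) auto
        then show ?thesis by (simp add: norm_mult)
      qed
      then have "u \<in> ?B" by (auto simp: cu)
      then obtain z where z: "z \<in> k" "dist z u < e / 4" using k(2) by auto
      have "cmod (coord (u - y) l) \<le> e / 4 * cmod (coord x l)" for l
      proof (cases "l \<in> ?F")
        case False
        then have "cmod (r l) \<le> e / 4" by simp
        from mult_right_mono[OF this norm_ge_zero[of "coord x l"]] show ?thesis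
          using False by (simp add: cu x(2) cR norm_mult)
      qed (use e in \<open>simp add: cu x(2) cR\<close>)
      then have "norm (u - y) \<le> e / 4 * norm x"
        using e by (intro norm_ell2_le_coordwise) auto
      also have "\<dots> \<le> e / 4" using x(1) e by simp
      finally have "dist z y \<le> e / 2" using z(2) dist_triangle[of z y u] by (simp add: dist_norm)
      then show "y \<in> (\<Union>x\<in>k. cball x (e / 2))" using z(1) by auto
    qed
    then have "closure ?S \<subseteq> (\<Union>x\<in>k. cball x (e / 2))"
      using k(1) by (intro closure_minimal closed_UN) auto
    also have "\<dots> \<subseteq> (\<Union>x\<in>k. ball x e)" using e by (intro UN_mono) auto
    finally show ?thesis using k(1) by blast
  qed
  ultimately show ?thesis unfolding compact_op_def compact_eq_totally_bounded by blast
qed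

text \<open>Infinitely many large entries would give distinct basis vectors whose images under
  \<open>R\<close> have a convergent subsequence. Only the square of \<open>R\<close> is assumed
  diagonal, so \<open>R\<close> is applied once more before comparing terms.\<close>

lemma compact_op_square_diag:
  assumes R: "compact_op R" and s: "\<And>x l. coord (R (R x)) l = s l * coord x l" and e: "0 < e"
  shows "finite {l. e \<le> cmod (s l)}"
proof (rule ccontr)
  assume "infinite {l. e \<le> cmod (s l)}"
  then obtain f :: "nat \<Rightarrow> int" where "inj f" "range f \<subseteq> {l. e \<le> cmod (s l)}"
    by (blast dest: infinite_countable_subset)
  then have f: "inj f" "\<And>k. e \<le> cmod (s (f k))" by auto
  have "norm (E l) = 1" for l by (simp add: norm_eq_sqrt_inner inner_ell2_def)
  then have "R (E (f k)) \<in> closure (blinfun_apply R ` cball 0 1)" for k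
    by (intro subsetD[OF closure_subset] imageI) simp
  then obtain y and \<sigma> :: "nat \<Rightarrow> nat" where \<sigma>: "strict_mono \<sigma>" "((\<lambda>k. R (E (f k))) \<circ> \<sigma>) \<longlonglongrightarrow> y"
    using R unfolding compact_op_def compact_def by (metis (no_types, lifting))
  then have "(\<lambda>k. R (R (E (f (\<sigma> k))))) \<longlonglongrightarrow> R y"
    by (intro tendsto_intros) (simp add: o_def)
  then have "Cauchy (\<lambda>k. R (R (E (f (\<sigma> k)))))" by (rule LIMSEQ_imp_Cauchy)
  then obtain M where "dist (R (R (E (f (\<sigma> M))))) (R (R (E (f (\<sigma> (Suc M)))))) < e"
    using e unfolding Cauchy_def by (metis le_Suc_eq order_refl)
  moreover have "f (\<sigma> M) \<noteq> f (\<sigma> (Suc M))"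
    using f(1) \<sigma>(1) by (metis injD lessI less_irrefl strict_mono_less)
  \<comment> \<open>At the coordinate \<open>f (\<sigma> M)\<close> only the first image
    contributes, so the two terms are at least \<open>e\<close> apart.\<close>
  then have "coord (R (R (E (f (\<sigma> M)))) - R (R (E (f (\<sigma> (Suc M)))))) (f (\<sigma> M)) = s (f (\<sigma> M))"
    by (simp add: s)
  then have "cmod (s (f (\<sigma> M))) \<le> norm (R (R (E (f (\<sigma> M)))) - R (R (E (f (\<sigma> (Suc M))))))"
    by (metis cmod_coord_le)
  ultimately show False using f(2)[of "\<sigma> M"] by (simp add: dist_norm)
qed

section \<open>Inverse square roots of multiplication operators\<close>

text \<open>The maximal domain is built in: \<open>w\<close> lies in \<open>ell2\<close>, which
  forces the product to be square-summable.\<close>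

definition mult_graph :: "(int \<Rightarrow> real) \<Rightarrow> (ell2 \<times> ell2) set" where
  "mult_graph a = {(x, w). \<forall>l. coord w l = of_real (a l) * coord x l}"

text \<open>As \<open>a\<close> is at least 1, multiplication by \<open>1 / sqrt (a l)\<close> is
  bounded by 1; its square divides by \<open>a\<close>, which inverts the relation.\<close>

lemma is_inv_sqrt_mult_graph:
  assumes a: "\<And>l. 1 \<le> a l"
  shows "is_inv_sqrt (mult_graph a) (diag_op (\<lambda>l. of_real (1 / sqrt (a l))))"
proof -
  define R where "R = diag_op (\<lambda>l. of_real (1 / sqrt (a l)))"
  have a0: "0 < a l" for l using a[of l] by linarith
  have cR: "coord (R x) l = of_real (1 / sqrt (a l)) * coord x l" for x l
    unfolding R_def by (rule coord_diag_op[where K = 1]) (use a a0 in \<open>auto simp: norm_divide less_imp_le\<close>)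
  have cRR: "coord (R (R x)) l = coord x l / of_real (a l)" for x l
  proof -
    have "complex_of_real (1 / sqrt (a l)) * of_real (1 / sqrt (a l)) = of_real (1 / a l)"
      using a0[of l] by (simp flip: of_real_mult)
    then show ?thesis unfolding cR mult.assoc[symmetric] by simp
  qed
  have "clinear (blinfun_apply R)"
    unfolding clinear_blinfun_iff by (intro allI ell2_eqI) (simp only: cR coord_cscale mult.left_commute)
  moreover have "cinner x (R x) \<in> \<real> \<and> 0 \<le> Re (cinner x (R x))" for x
  proof -
    let ?f = "\<lambda>l. 1 / sqrt (a l) * (cmod (coord x l))\<^sup>2"
    have "cnj z * (of_real t * z) = of_real (t * (cmod z)\<^sup>2)" for z t
      using complex_norm_square[of z] by (simp add: mult_ac)
    then have eq: "cnj (coord x l) * coord (R x) l = of_real (?f l)" for l unfolding cR .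
    have "?f summable_on UNIV"
    proof (rule summable_on_comparison_test[OF coord_summable])
      fix l
      have "1 \<le> sqrt (a l)" using a by simp
      then show "?f l \<le> (cmod (coord x l))\<^sup>2" by (simp add: divide_le_eq mult_left_le mult_le_cancel_left1)
      show "0 \<le> ?f l" using a0[of l] by simp
    qed
    then have "cinner x (R x) = of_real (infsum ?f UNIV)"
      unfolding cinner_def eq by (intro infsumI has_sum_of_real has_sum_infsum)
    moreover have "0 \<le> infsum ?f UNIV" using a0 by (intro infsum_nonneg) (simp add: less_imp_le)
    ultimately show ?thesis by simp
  qed
  moreover have "op_graph (\<lambda>x. R (R x)) UNIV = (mult_graph a)\<inverse>"
  proof -
    have "R (R w) = x \<longleftrightarrow> (\<forall>l. coord w l = of_real (a l) * coord x l)" for w x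
    proof -
      have "R (R w) = x \<longleftrightarrow> (\<forall>l. coord w l / of_real (a l) = coord x l)"
        using ell2_eqI[of "R (R w)" x] by (auto simp: cRR)
      also have "\<dots> \<longleftrightarrow> (\<forall>l. coord w l = of_real (a l) * coord x l)"
        using a0 by (intro all_cong1) (metis divide_eq_eq less_irrefl mult.commute of_real_eq_0_iff)
      finally show ?thesis .
    qed
    then have "x = R (R w) \<longleftrightarrow> (\<forall>l. coord w l = of_real (a l) * coord x l)" for w x by metis
    then show ?thesis by (auto simp: op_graph_def mult_graph_def)
  qed
  ultimately show ?thesis by (simp add: is_inv_sqrt_def R_def)
qed

text \<open>The graph equation identifies the square of \<open>R\<close> with division by
  \<open>a\<close>, while \<open>R\<close> itself is left undetermined.\<close>

lemma is_inv_sqrt_mult_graphD: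
  assumes "is_inv_sqrt (mult_graph a) R" and a: "\<And>l. 1 \<le> a l"
  shows "coord (R (R x)) l = of_real (1 / a l) * coord x l"
proof -
  have "(x, R (R x)) \<in> (mult_graph a)\<inverse>"
    using assms(1) by (auto simp: is_inv_sqrt_def op_graph_def)
  then have "coord x l = of_real (a l) * coord (R (R x)) l" by (simp add: mult_graph_def)
  then show ?thesis using a[of l] by auto
qed

lemma compact_inv_sqrt_iff:
  fixes d :: "int \<Rightarrow> complex"
  shows "(\<exists>R. is_inv_sqrt (mult_graph (\<lambda>l. 1 + (cmod (d l))\<^sup>2)) R \<and> compact_op R) \<longleftrightarrow>
    (\<forall>C. finite {l. cmod (d l) \<le> C})"
proof
  let ?a = "\<lambda>l. 1 + (cmod (d l))\<^sup>2"
  assume "\<exists>R. is_inv_sqrt (mult_graph ?a) R \<and> compact_op R"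
  then obtain R where R: "is_inv_sqrt (mult_graph ?a) R" "compact_op R" by blast
  show "\<forall>C. finite {l. cmod (d l) \<le> C}"
  proof
    fix C
    have "coord (R (R x)) l = of_real (1 / ?a l) * coord x l" for x l
      by (rule is_inv_sqrt_mult_graphD[OF R(1)]) simp
    \<comment> \<open>A weight of size at most \<open>C\<close> forces the entry
      \<open>1 / ?a l\<close> of the square to be at least the positive threshold
      \<open>1 / (1 + C\<^sup>2)\<close>.\<close>
    from compact_op_square_diag[OF R(2) this]
    have "finite {l. 1 / (1 + C\<^sup>2) \<le> cmod (of_real (1 / ?a l))}" by (simp add: add_pos_nonneg)
    moreover have "1 / (1 + C\<^sup>2) \<le> cmod (of_real (1 / ?a l))" if "cmod (d l) \<le> C" for l
    proof -
      have "(cmod (d l))\<^sup>2 \<le> C\<^sup>2" using that by (intro power_mono) auto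
      then show ?thesis by (simp only: norm_of_real) (simp add: frac_le add_pos_nonneg)
    qed
    ultimately show "finite {l. cmod (d l) \<le> C}" by (elim finite_subset[rotated]) blast
  qed
next
  let ?a = "\<lambda>l. 1 + (cmod (d l))\<^sup>2"
  assume fin: "\<forall>C. finite {l. cmod (d l) \<le> C}"
  have "compact_op (diag_op (\<lambda>l. of_real (1 / sqrt (?a l))))"
  proof (rule compact_op_diag)
    fix e :: real assume e: "0 < e"
    \<comment> \<open>\<open>cmod (d l)\<close> is at most \<open>sqrt (?a l)\<close>, whose
      reciprocal is the entry.\<close>
    have "cmod (d l) \<le> 1 / e" if "e \<le> cmod (of_real (1 / sqrt (?a l)))" for l
    proof -
      have "cmod (d l) \<le> sqrt (?a l)" by (rule real_le_rsqrt) simp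
      moreover have "e * sqrt (?a l) \<le> 1"
        using that by (simp add: norm_divide pos_le_divide_eq add_pos_nonneg)
      ultimately have "e * cmod (d l) \<le> 1" using e by (meson mult_left_mono less_imp_le order_trans)
      then show ?thesis using e by (simp add: pos_le_divide_eq mult.commute)
    qed
    then show "finite {l. e \<le> cmod (of_real (1 / sqrt (?a l)))}"
      by (intro finite_subset[OF _ fin[rule_format, of "1 / e"]]) blast
  next
    have "1 \<le> sqrt (?a l)" for l by simp
    then show "cmod (of_real (1 / sqrt (?a l))) \<le> 1" for l
      by (simp only: norm_of_real) (simp add: divide_le_eq_1_pos add_pos_nonneg)
  qed
  then show "\<exists>R. is_inv_sqrt (mult_graph ?a) R \<and> compact_op R"
    using is_inv_sqrt_mult_graph[of ?a] by auto
qed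

text \<open>Bounded sets of integers are exactly the finite ones, so this filter is the cofinite one
  and divergence becomes finiteness of sublevel sets.\<close>

lemma eventually_filtercomap_abs_int:
  "eventually P (filtercomap abs (at_top :: int filter)) \<longleftrightarrow> finite {l. \<not> P l}"
proof
  assume "eventually P (filtercomap abs at_top)"
  then obtain M where "\<And>l. M \<le> \<bar>l\<bar> \<Longrightarrow> P l"
    by (auto simp: eventually_filtercomap eventually_at_top_linorder)
  then have "{l. \<not> P l} \<subseteq> {- M..M}" by force
  then show "finite {l. \<not> P l}" by (rule finite_subset) simp
next
  assume fin: "finite {l. \<not> P l}"
  have "P l" if "Max (insert 0 (abs ` {l. \<not> P l})) + 1 \<le> \<bar>l\<bar>" for l
  proof (rule ccontr)
    assume "\<not> P l"
    then have "\<bar>l\<bar> \<le> Max (insert 0 (abs ` {l. \<not> P l}))" using fin by (intro Max_ge) auto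
    with that show False by linarith
  qed
  then show "eventually P (filtercomap abs at_top)"
    unfolding eventually_filtercomap eventually_at_top_linorder by blast
qed

lemma filterlim_cmod_at_infinity_iff:
  "filterlim (\<lambda>l. cmod (d l)) at_top (filtercomap abs (at_top :: int filter)) \<longleftrightarrow> (\<forall>C. finite {l. cmod (d l) \<le> C})"
  by (simp add: filterlim_at_top_dense eventually_filtercomap_abs_int not_less)


section \<open>Closures and adjoints of weighted shifts\<close>

text \<open>The weighted shift on its maximal domain, the domain condition being that
  \<open>y\<close> lies in \<open>ell2\<close>.\<close>

definition wgraph :: "int \<Rightarrow> (int \<Rightarrow> complex) \<Rightarrow> (ell2 \<times> ell2) set" where
  "wgraph n d = {(x, y). \<forall>l. coord y (l + n) = d l * coord x l}"

definition trunc :: "int set \<Rightarrow> ell2 \<Rightarrow>\<^sub>L ell2" where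
  "trunc F = diag_op (\<lambda>l. if l \<in> F then 1 else 0)"

lemma coord_trunc [simp]: "coord (trunc F x) l = (if l \<in> F then coord x l else 0)"
  unfolding trunc_def by (subst coord_diag_op[where K = 1]) auto

text \<open>By Pythagoras the squared error is the full sum of squares minus its partial sum over
  \<open>F\<close>.\<close>

lemma trunc_tendsto: "((\<lambda>F. trunc F x) \<longlongrightarrow> x) (finite_subsets_at_top UNIV)"
proof -
  have pyth: "(norm (x - trunc F x))\<^sup>2 = (norm x)\<^sup>2 - (\<Sum>l\<in>F. (cmod (coord x l))\<^sup>2)" if F: "finite F" for F
  proof -
    have "(norm x)\<^sup>2 = (\<Sum>\<^sub>\<infinity>l. (cmod (coord (trunc F x) l))\<^sup>2 + (cmod (coord (x - trunc F x) l))\<^sup>2)"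
      unfolding norm_ell2_sq by (intro infsum_cong) auto
    also have "\<dots> = (\<Sum>\<^sub>\<infinity>l. (cmod (coord (trunc F x) l))\<^sup>2) + (norm (x - trunc F x))\<^sup>2"
      unfolding norm_ell2_sq by (intro infsum_add coord_summable)
    also have "(\<Sum>\<^sub>\<infinity>l. (cmod (coord (trunc F x) l))\<^sup>2) = (\<Sum>\<^sub>\<infinity>l\<in>F. (cmod (coord x l))\<^sup>2)"
      by (rule infsum_cong_neutral) auto
    also have "\<dots> = (\<Sum>l\<in>F. (cmod (coord x l))\<^sup>2)" using F by simp
    finally show ?thesis by simp
  qed
  have "(sum (\<lambda>l. (cmod (coord x l))\<^sup>2) \<longlongrightarrow> (norm x)\<^sup>2) (finite_subsets_at_top UNIV)"
    using has_sum_infsum[OF coord_summable[of x]] unfolding norm_ell2_sq has_sum_def .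
  then have "((\<lambda>F. (norm x)\<^sup>2 - (\<Sum>l\<in>F. (cmod (coord x l))\<^sup>2)) \<longlongrightarrow> (norm x)\<^sup>2 - (norm x)\<^sup>2)
      (finite_subsets_at_top UNIV)"
    by (intro tendsto_intros)
  then have "((\<lambda>F. (norm (x - trunc F x))\<^sup>2) \<longlongrightarrow> (norm x)\<^sup>2 - (norm x)\<^sup>2) (finite_subsets_at_top UNIV)"
    by (rule Lim_transform_eventually) (rule eventually_finite_subsets_at_top_weakI, rule pyth[symmetric])
  then have "((\<lambda>F. (norm (x - trunc F x))\<^sup>2) \<longlongrightarrow> 0) (finite_subsets_at_top UNIV)"
    by (simp only: diff_self)
  then have "((\<lambda>F. sqrt ((norm (x - trunc F x))\<^sup>2)) \<longlongrightarrow> sqrt 0) (finite_subsets_at_top UNIV)"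
    by (rule tendsto_real_sqrt)
  moreover have "sqrt ((norm (x - trunc F x))\<^sup>2) = dist (trunc F x) x" for F
    using dist_commute[of x "trunc F x"] by (simp add: dist_norm)
  ultimately have "((\<lambda>F. dist (trunc F x) x) \<longlongrightarrow> 0) (finite_subsets_at_top UNIV)" by simp
  then show ?thesis by (rule tendsto_dist_iff[THEN iffD2])
qed

lemma closed_wgraph: "closed (wgraph n d)"
proof -
  have "wgraph n d = (\<Inter>l. {p. coord (snd p) (l + n) = d l * coord (fst p) l})"
    by (auto simp: wgraph_def)
  moreover have "closed (\<Inter>l. {p. coord (snd p) (l + n) = d l * coord (fst p) l})"
    by (intro closed_INT ballI closed_Collect_eq continuous_intros
        bounded_linear.continuous_on[OF bounded_linear_coord])
  ultimately show ?thesis by simp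
qed

text \<open>Finitely supported vectors form a core: truncating \<open>x\<close> truncates its image
  correspondingly, and both truncations converge.\<close>

lemma closure_op_graph:
  assumes D: "\<And>x. x \<in> cvs.span (range E) \<Longrightarrow> D x = wshift n d x"
  shows "closure (op_graph D (cvs.span (range E))) = wgraph n d"
proof (intro subset_antisym subsetI)
  have "op_graph D (cvs.span (range E)) \<subseteq> wgraph n d"
    by (auto simp: op_graph_def wgraph_def D coord_wshift)
  then show "p \<in> wgraph n d" if "p \<in> closure (op_graph D (cvs.span (range E)))" for p
    using closure_minimal[OF _ closed_wgraph] that by blast
next
  fix p assume "p \<in> wgraph n d"
  then obtain x y where p: "p = (x, y)" and y: "\<And>l. coord y (l + n) = d l * coord x l"
    by (auto simp: wgraph_def)
  have S: "trunc F x \<in> cvs.span (range E)" if "finite F" for F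
    using that unfolding span_E_iff by (rule finite_subset[rotated]) auto
  have "D (trunc F x) = Vpow n (trunc F (Vpow (- n) y))" if "finite F" for F
    using y[of "l - n" for l] by (intro ell2_eqI) (simp add: D S that coord_wshift)
  then have "(trunc F x, Vpow n (trunc F (Vpow (- n) y))) \<in> op_graph D (cvs.span (range E))"
    if "finite F" for F
    using S that by (auto simp: op_graph_def)
  then have ev: "\<forall>\<^sub>F F in finite_subsets_at_top UNIV.
      (trunc F x, Vpow n (trunc F (Vpow (- n) y))) \<in> closure (op_graph D (cvs.span (range E)))"
    using closure_subset by (intro eventually_finite_subsets_at_top_weakI) blast
  have lim: "((\<lambda>F. (trunc F x, Vpow n (trunc F (Vpow (- n) y)))) \<longlongrightarrow> (x, Vpow n (Vpow (- n) y)))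
      (finite_subsets_at_top UNIV)"
    by (intro tendsto_intros trunc_tendsto)
  have "(x, Vpow n (Vpow (- n) y)) \<in> closure (op_graph D (cvs.span (range E)))"
    by (rule Lim_in_closed_set[OF closed_closure ev finite_subsets_at_top_neq_bot lim])
  moreover have "Vpow n (Vpow (- n) y) = y" by (rule ell2_eqI) simp
  ultimately show "p \<in> closure (op_graph D (cvs.span (range E)))" by (simp add: p)
qed

text \<open>Testing against basis vectors determines the adjoint weights; conversely, translating
  the summation index by \<open>n\<close> verifies the pairing.\<close>

lemma adj_graph_wgraph: "adj_graph (wgraph n d) = wgraph (- n) (\<lambda>l. cnj (d (l - n)))"
proof (intro subset_antisym subsetI)
  fix p assume "p \<in> adj_graph (wgraph n d)"
  moreover obtain y z where p: "p = (y, z)" by (cases p)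
  ultimately have adj: "cinner w y = cinner x z" if "(x, w) \<in> wgraph n d" for x w
    using that unfolding adj_graph_def by fast
  have "coord z (l - n) = cnj (d (l - n)) * coord y l" for l
  proof -
    have "(E (l - n), cscale (d (l - n)) (E l)) \<in> wgraph n d" by (auto simp: wgraph_def)
    from adj[OF this] show ?thesis by (simp add: cinner_cscale_left)
  qed
  then show "p \<in> wgraph (- n) (\<lambda>l. cnj (d (l - n)))" by (simp add: p wgraph_def)
next
  fix p assume "p \<in> wgraph (- n) (\<lambda>l. cnj (d (l - n)))"
  then obtain y z where p: "p = (y, z)" and z': "\<And>l. coord z (l - n) = cnj (d (l - n)) * coord y l"
    by (auto simp: wgraph_def)
  have z: "coord z l = cnj (d l) * coord y (l + n)" for l using z'[of "l + n"] by simp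
  have "cinner w y = cinner x z" if "(x, w) \<in> wgraph n d" for x w
  proof -
    have w: "coord w (l + n) = d l * coord x l" for l using that by (simp add: wgraph_def)
    have "cinner w y = (\<Sum>\<^sub>\<infinity>l. cnj (coord w (l + n)) * coord y (l + n))"
      unfolding cinner_def
      using infsum_reindex_bij_betw[OF bij_shift[of "- n"], of "\<lambda>l. cnj (coord w l) * coord y l"] by simp
    also have "\<dots> = cinner x z" unfolding cinner_def w z by (simp add: mult_ac)
    finally show ?thesis .
  qed
  then show "p \<in> adj_graph (wgraph n d)" by (auto simp: p adj_graph_def)
qed

text \<open>Lets the product in the other order be computed as the first one for the adjoint
  shift.\<close>

lemma adj_adj_graph_wgraph: "adj_graph (adj_graph (wgraph n d)) = wgraph n d"
  by (simp add: adj_graph_wgraph)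

text \<open>The weights multiply to \<open>(cmod (d l))\<^sup>2\<close>; the point is the domain,
  where an intermediate vector has to be produced.\<close>

lemma one_plus_wgraph: "one_plus (wgraph n d O adj_graph (wgraph n d)) = mult_graph (\<lambda>l. 1 + (cmod (d l))\<^sup>2)"
proof -
  have "(x, z) \<in> wgraph n d O adj_graph (wgraph n d) \<longleftrightarrow> (\<forall>l. coord z l = of_real ((cmod (d l))\<^sup>2) * coord x l)"
    for x z
  proof
    assume "(x, z) \<in> wgraph n d O adj_graph (wgraph n d)"
    then obtain y where y: "\<And>l. coord y (l + n) = d l * coord x l"
      and z: "\<And>l. coord z (l - n) = cnj (d (l - n)) * coord y l"
      unfolding adj_graph_wgraph unfolding wgraph_def by auto
    show "\<forall>l. coord z l = of_real ((cmod (d l))\<^sup>2) * coord x l"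
      using z[of "l + n" for l] by (simp add: y complex_norm_square mult_ac del: of_real_power)
  next
    assume z: "\<forall>l. coord z l = of_real ((cmod (d l))\<^sup>2) * coord x l"
    \<comment> \<open>The squared entries of the intermediate vector are the absolute terms of
      \<open>cinner x z\<close>, hence summable.\<close>
    have "(cmod (d l * coord x l))\<^sup>2 = cmod (cnj (coord x l) * coord z l)" for l
      using z by (simp add: norm_mult norm_power power_mult_distrib) (simp add: power2_eq_square mult_ac)
    then have "(\<lambda>l. (cmod (d l * coord x l))\<^sup>2) summable_on UNIV"
      using cinner_abs_summable[of x z] by simp
    then have "coord (Abs_ell2 (\<lambda>l. d l * coord x l)) l = d l * coord x l" for l
      by (simp add: Abs_ell2_inverse)
    then have "(x, Vpow n (Abs_ell2 (\<lambda>l. d l * coord x l))) \<in> wgraph n d"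
      "(Vpow n (Abs_ell2 (\<lambda>l. d l * coord x l)), z) \<in> adj_graph (wgraph n d)"
      using z unfolding adj_graph_wgraph by (simp_all add: wgraph_def complex_norm_square mult_ac del: of_real_power)
    then show "(x, z) \<in> wgraph n d O adj_graph (wgraph n d)" by blast
  qed
  note * = this
  have "(x, w) \<in> one_plus (wgraph n d O adj_graph (wgraph n d)) \<longleftrightarrow>
      (x, w) \<in> mult_graph (\<lambda>l. 1 + (cmod (d l))\<^sup>2)" for x w
  proof -
    have "(x, w) \<in> one_plus (wgraph n d O adj_graph (wgraph n d)) \<longleftrightarrow>
        (x, w - x) \<in> wgraph n d O adj_graph (wgraph n d)"
    proof
      assume "(x, w - x) \<in> wgraph n d O adj_graph (wgraph n d)"
      then show "(x, w) \<in> one_plus (wgraph n d O adj_graph (wgraph n d))"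
        unfolding one_plus_def by (intro CollectI exI[of _ x] exI[of _ "w - x"]) simp
    qed (auto simp: one_plus_def)
    then show ?thesis unfolding * mult_graph_def by (simp add: algebra_simps)
  qed
  then show ?thesis by auto
qed

text \<open>The second half of the definition concerns the conjugated, translated weight, whose
  sublevel sets are translates of those of \<open>d\<close>; both halves impose the same
  condition.\<close>

lemma compact_parametrices_iff:
  assumes "\<And>x. x \<in> cvs.span (range E) \<Longrightarrow> D x = wshift n d x"
  shows "compact_parametrices D (cvs.span (range E)) \<longleftrightarrow> (\<forall>C. finite {l. cmod (d l) \<le> C})"
proof -
  let ?G = "wgraph n d" and ?d = "\<lambda>l. cnj (d (l - n))"
  have "one_plus (adj_graph ?G O ?G) = mult_graph (\<lambda>l. 1 + (cmod (?d l))\<^sup>2)"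
    using one_plus_wgraph[of "- n" ?d] adj_adj_graph_wgraph[of n d] by (simp add: adj_graph_wgraph)
  moreover have "finite {l. cmod (d l) \<le> C} \<Longrightarrow> finite {l. cmod (?d l) \<le> C}" for C
  proof (rule finite_subset)
    show "{l. cmod (?d l) \<le> C} \<subseteq> (\<lambda>l. l + n) ` {l. cmod (d l) \<le> C}"
      by (auto intro!: image_eqI[where x = "l - n" for l])
  qed simp
  moreover have "closure (op_graph D (cvs.span (range E))) = ?G"
    by (rule closure_op_graph) (rule assms)
  ultimately show ?thesis
    unfolding compact_parametrices_def Let_def
    by (simp only: one_plus_wgraph compact_inv_sqrt_iff) blast
qed


section \<open>Divisors of supernatural numbers\<close>

lemma sn_dvd_sn_nat: "sn_dvd (sn_nat N) N"
proof -
  let ?S = "{p. prime p \<and> N p \<noteq> 0}"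
  show ?thesis
  proof (cases "finite ?S")
    case True
    have "enat (multiplicity p (sn_nat N)) \<le> N p" if p: "prime p" for p
    proof -
      have "multiplicity p (sn_nat N) = (if p \<in> ?S then the_enat (N p) else 0)"
        unfolding sn_nat_def by (rule multiplicity_prod_prime_powers) (use True p in auto)
      \<comment> \<open>An infinite exponent bounds every multiplicity, whatever value
        \<open>the_enat\<close> takes there.\<close>
      then show ?thesis by (cases "N p") (auto simp: zero_enat_def)
    qed
    moreover have "0 < sn_nat N" unfolding sn_nat_def by (rule prod_pos) (simp add: prime_gt_0_nat)
    ultimately show ?thesis by (simp add: sn_dvd_def)
  next
    case False
    \<comment> \<open>A product over an infinite set is 1 by convention.\<close>
    then show ?thesis using sn_dvd_1[of N] by (simp add: sn_nat_def)
  qed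
qed

text \<open>A number exceeding the absolute value of a nonzero \<open>n\<close> cannot divide it.
  Such a \<open>j\<close> is a power of a prime with infinite exponent or, if all exponents are
  finite, a large one among the infinitely many primes that occur.\<close>

lemma sn_infinite_divisor:
  assumes inf: "\<not> sn_finite N" and n: "n \<noteq> 0"
  obtains j where "sn_dvd j N" "\<not> int j dvd n"
proof (cases "\<exists>p. prime p \<and> N p = \<infinity>")
  case True
  then obtain p where p: "prime p" "N p = \<infinity>" by blast
  show ?thesis
  proof (rule that)
    let ?k = "nat \<bar>n\<bar>"
    have "multiplicity q (p ^ ?k) = (if q = p then ?k else 0)" if "prime q" for q
      using that p(1) by (auto simp: multiplicity_distinct_prime_power multiplicity_same_power)
    then show "sn_dvd (p ^ ?k) N"
      using p by (auto simp: sn_dvd_def prime_gt_0_nat simp flip: zero_enat_def)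
    show "\<not> int (p ^ ?k) dvd n"
    proof
      assume "int (p ^ ?k) dvd n"
      then have "\<bar>int (p ^ ?k)\<bar> \<le> \<bar>n\<bar>" using n by (rule dvd_imp_le_int[rotated])
      then have "p ^ ?k \<le> ?k" by linarith
      moreover have "?k < p ^ ?k" using prime_gt_1_nat[OF p(1)] by (simp add: power_gt_expt)
      ultimately show False by simp
    qed
  qed
next
  case False
  let ?S = "{p. prime p \<and> N p \<noteq> 0}"
  have "infinite ?S"
  proof
    assume fin: "finite ?S"
    have "infsum N {p. prime p} = infsum N ?S" by (rule infsum_cong_neutral) auto
    also have "\<dots> = sum N ?S" using fin by simp
    also have "\<dots> < \<infinity>"
    proof -
      have *: "sum N S < \<infinity>" if "finite S" "\<forall>p\<in>S. N p \<noteq> \<infinity>" for S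
        using that by (induction S) (auto simp: plus_eq_infty_iff_enat)
      show ?thesis by (rule *[OF fin]) (use False in auto)
    qed
    finally show False using inf by (simp add: sn_finite_def)
  qed
  then obtain p where p: "p \<in> ?S" "nat \<bar>n\<bar> < p"
    by (meson finite_nat_set_iff_bounded_le not_le)
  show ?thesis
  proof (rule that)
    have "enat (multiplicity q p) \<le> N q" if q: "prime q" for q
    proof (cases "q = p")
      case True
      then have "enat (multiplicity q p) = 1"
        using p(1) by (auto simp: one_enat_def)
      then show ?thesis using p(1) True by (cases "N p") (auto simp: one_enat_def zero_enat_def)
    next
      case False
      then have "multiplicity q p = 0"
        using q p(1) multiplicity_distinct_prime_power[of q p 1] by auto
      then show ?thesis by (simp flip: zero_enat_def)
    qed
    then show "sn_dvd p N"
      using p(1) by (auto simp: sn_dvd_def prime_gt_0_nat)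
    show "\<not> int p dvd n" using p(2) n by (auto dest: dvd_imp_le_int)
  qed
qed


section \<open>The classification of covariant implementations\<close>

text \<open>The threshold moves by \<open>cmod c\<close>. Since implementing weights differ by
  constants, the growth criterion can be stated for any of them.\<close>

lemma finite_sublevels_add_const:
  fixes d :: "int \<Rightarrow> complex"
  assumes "\<forall>C. finite {l. cmod (d l) \<le> C}" "\<And>l. d' l = d l + c"
  shows "\<forall>C. finite {l. cmod (d' l) \<le> C}"
proof
  fix C
  have "cmod (d l) \<le> C + cmod c" if "cmod (d' l) \<le> C" for l
    using norm_triangle_ineq4[of "d' l" c] that assms(2)[of l] by simp
  then have "{l. cmod (d' l) \<le> C} \<subseteq> {l. cmod (d l) \<le> C + cmod c}" by blast
  then show "finite {l. cmod (d' l) \<le> C}" using assms(1) finite_subset by blast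
qed

theorem theorem5p2:
  fixes N :: supernatural and n :: int
    and \<delta> :: "(ell2 \<Rightarrow>\<^sub>L ell2) \<Rightarrow> (ell2 \<Rightarrow>\<^sub>L ell2)"
  assumes "covariant_derivation N n \<delta>"
  shows
    "(\<exists>\<eta>. implemented_by N n \<delta> \<eta>)
     \<and> (\<forall>D. covariant_implementation N n \<delta> D \<longrightarrow>
          (n \<noteq> 0 \<longrightarrow> (\<exists>\<eta>. implemented_by N n \<delta> \<eta> \<and>
              (\<forall>x\<in>gns_domain N. D x = Vpow n (diag \<eta> x))))
          \<and> (n = 0 \<longrightarrow> (\<forall>\<eta>. implemented_by N n \<delta> \<eta> \<longrightarrow>
              (\<exists>c. \<forall>x\<in>gns_domain N. D x = diag \<eta> x + cscale c x)))
          \<and> (if (\<not> sn_finite N \<and> n \<noteq> 0) \<or> (sn_finite N \<and> \<not> int (sn_nat N) dvd n)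
             then bounded_on_domain D (gns_domain N) \<and> \<not> compact_parametrices D (gns_domain N)
             else (\<forall>\<eta>. implemented_by N n \<delta> \<eta> \<longrightarrow>
               (compact_parametrices D (gns_domain N) \<longleftrightarrow>
                filterlim (\<lambda>l. cmod (\<eta> l)) at_top (filtercomap abs at_top)))))
     \<and> (n = 0 \<longrightarrow> (\<forall>\<eta> c. implemented_by N n \<delta> \<eta> \<longrightarrow>
          covariant_implementation N n \<delta> (\<lambda>x. diag \<eta> x + cscale c x)))"
proof (intro conjI allI impI)
  \<comment> \<open>Either some \<open>j\<close> dividing \<open>N\<close> does not divide
    \<open>n\<close>, or every such \<open>j\<close> does.\<close>
  show "\<exists>\<eta>. implemented_by N n \<delta> \<eta>"
    using implemented_by_exists_non_dividing[OF assms] implemented_by_exists_dividing[OF assms] by blast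
next
  fix D assume "covariant_implementation N n \<delta> D"
  then obtain d where D: "\<And>x. x \<in> gns_domain N \<Longrightarrow> D x = wshift n d x" and d: "implemented_by N n \<delta> d"
    by (rule covariant_implementation_form) blast
  { assume "n \<noteq> 0"
    show "\<exists>\<eta>. implemented_by N n \<delta> \<eta> \<and> (\<forall>x\<in>gns_domain N. D x = Vpow n (diag \<eta> x))"
      using D d by (auto simp: wshift_def) }
  { fix \<eta> assume n: "n = 0" and \<eta>: "implemented_by N n \<delta> \<eta>"
    obtain c where c: "\<And>l. d l = \<eta> l + c" using implemented_by_unique[OF \<eta> d] by blast
    have "D x = diag \<eta> x + cscale c x" if "x \<in> gns_domain N" for x
      using D[OF that] that n unfolding gns_domain_eq
      by (intro ell2_eqI) (simp add: coord_wshift coord_diag_span c distrib_right)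
    then show "\<exists>c. \<forall>x\<in>gns_domain N. D x = diag \<eta> x + cscale c x" by blast }
  have cp: "compact_parametrices D (gns_domain N) \<longleftrightarrow> (\<forall>C. finite {l. cmod (d l) \<le> C})"
    using compact_parametrices_iff[of D n d] D unfolding gns_domain_eq by blast
  let ?cases = "(\<not> sn_finite N \<and> n \<noteq> 0) \<or> (sn_finite N \<and> \<not> int (sn_nat N) dvd n)"
  show "if ?cases
      then bounded_on_domain D (gns_domain N) \<and> \<not> compact_parametrices D (gns_domain N)
      else (\<forall>\<eta>. implemented_by N n \<delta> \<eta> \<longrightarrow>
        (compact_parametrices D (gns_domain N) \<longleftrightarrow>
         filterlim (\<lambda>l. cmod (\<eta> l)) at_top (filtercomap abs at_top)))"
  proof (cases ?cases)
    case True
    \<comment> \<open>For infinite \<open>N\<close> a suitable divisor exists by size; for finite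
      \<open>N\<close> it is \<open>sn_nat N\<close>.\<close>
    then obtain j where "sn_dvd j N" "\<not> int j dvd n"
      using sn_infinite_divisor sn_dvd_sn_nat by metis
    then obtain K where K: "\<And>l. cmod (d l) \<le> K" using implemented_by_bounded[OF d] by blast
    have "norm (D x) \<le> norm (Vpow n) * K * norm x" if "x \<in> gns_domain N" for x
    proof -
      have "0 \<le> K" using order_trans[OF norm_ge_zero K] .
      then have "norm (diag d x) \<le> K * norm x"
        by (intro norm_ell2_le_coordwise) (simp_all add: coord_diag_bounded[OF K] norm_mult K mult_right_mono)
      then have "norm (Vpow n) * norm (diag d x) \<le> norm (Vpow n) * (K * norm x)"
        by (intro mult_left_mono) auto
      then show ?thesis
        using norm_blinfun[of "Vpow n" "diag d x"] by (simp add: D[OF that] wshift_def mult.assoc)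
    qed
    then have "bounded_on_domain D (gns_domain N)" unfolding bounded_on_domain_def by blast
    \<comment> \<open>A bounded weight has an infinite sublevel set, against the criterion.\<close>
    moreover have "{l. cmod (d l) \<le> K} = UNIV" using K by auto
    then have "\<not> compact_parametrices D (gns_domain N)"
      unfolding cp by (metis infinite_UNIV_int)
    ultimately show ?thesis using True by simp
  next
    case False
    have "compact_parametrices D (gns_domain N) \<longleftrightarrow>
        filterlim (\<lambda>l. cmod (\<eta> l)) at_top (filtercomap abs at_top)"
      if \<eta>: "implemented_by N n \<delta> \<eta>" for \<eta>
    proof -
      obtain c where c: "\<And>l. d l = \<eta> l + c" using implemented_by_unique[OF \<eta> d] by blast
      then have "\<eta> l = d l + - c" for l by simp
      then show ?thesis
        unfolding cp filterlim_cmod_at_infinity_iff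
        using finite_sublevels_add_const[of d \<eta> "- c"] finite_sublevels_add_const[of \<eta> d c] c by blast
    qed
    then show ?thesis unfolding if_not_P[OF False] by blast
  qed
next
  fix \<eta> c assume "n = 0" "implemented_by N n \<delta> \<eta>"
  then show "covariant_implementation N n \<delta> (\<lambda>x. diag \<eta> x + cscale c x)"
    using implemented_by_covariant_implementation by blast
qed

end
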